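(* Let $m\ge 1$, $q_0=2^m$, $q=2^{2m+1}=2q_0^2$, and let $X_m$ be the Suzuki curve over $\mathbb{F}_q$ (defined in the context). Let $D$ be the divisor on $X_m$ equal to the sum of all $\mathbb{F}_q$-rational points of $X_m$, i.e. $D=P_\infty+\sum_{\alpha,\beta\in\mathbb{F}_q}P_{\alpha,\beta}$, where $P_{\alpha,\beta}$ is the affine point with coordinates $(\alpha,\beta)$. Let $\ell\in\mathbb{N}$ with $\ell\le q^2-1$. Then the set $$S=\left\{\frac{x^a y^b z^c w^d}{(x^q+x)^r} : \begin{array}{l} aq+b(q+q_0)+c(q+2q_0)+d(q+2q_0+1)\le rq^2+\ell,\\ 0\le a\le q-1,\ 0\le b\le 1,\ 0\le c\le q_0-1,\\ 0\le d\le q_0-1,\ 0\le r\le \ell\end{array}\right\}$$ is an $\mathbb{F}_q$-basis of the Riemann–Roch space $\mathcal{L}(\ell D)$.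
   Context: The Suzuki curve $X_m$ is the smooth projective curve over $\mathbb{F}_q$ with affine plane equation $y^q+y=x^{q_0}(x^q+x)$. It has a unique point $P_\infty$ lying over the point at infinity of the plane model; its genus is $g=q_0(q-1)$ and it has exactly $q^2+1$ $\mathbb{F}_q$-rational points (namely $P_\infty$ and the $q^2$ affine points $(\alpha,\beta)$ with $\alpha,\beta\in\mathbb{F}_q$). The functions $x,y$ are the coordinate functions, $z:=x^{2q_0+1}-y^{2q_0}$ and $w:=xy^{2q_0}-z^{2q_0}$; the functions $x,y,z,w$ are regular outside $P_\infty$ with pole orders at $P_\infty$ equal to $q$, $q+q_0$, $q+2q_0$, $q+2q_0+1$ respectively. For a divisor $G$, $\mathcal{L}(G)=\{f: \operatorname{div}(f)+G\ge 0\}\cup\{0\}$. *)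

theory Defs
  imports "HOL-Computational_Algebra.Polynomial" "HOL-Library.Cardinality"
begin

text \<open>The constant field F_q is a finite field type 'f, the function field of the
Suzuki curve is an abstract field 'K containing a copy of 'f via the embedding iota.\<close>

definition suz_q0 :: "nat \<Rightarrow> nat" where "suz_q0 m = 2 ^ m"
definition suz_q :: "nat \<Rightarrow> nat" where "suz_q m = 2 ^ (2 * m + 1)"

definition is_field_hom :: "('f::field \<Rightarrow> 'K::field) \<Rightarrow> bool" where
  "is_field_hom \<iota> \<longleftrightarrow> \<iota> 1 = 1 \<and> (\<forall>a b. \<iota> (a + b) = \<iota> a + \<iota> b) \<and> (\<forall>a b. \<iota> (a * b) = \<iota> a * \<iota> b)"

definition is_subfield :: "'K::field set \<Rightarrow> bool" where
  "is_subfield S \<longleftrightarrow> 0 \<in> S \<and> 1 \<in> S \<and> (\<forall>a\<in>S. \<forall>b\<in>S. a + b \<in> S \<and> a * b \<in> S \<and> a - b \<in> S)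
     \<and> (\<forall>a\<in>S. a \<noteq> 0 \<longrightarrow> inverse a \<in> S)"

definition generated_by :: "('f::field \<Rightarrow> 'K::field) \<Rightarrow> 'K \<Rightarrow> 'K \<Rightarrow> bool" where
  "generated_by \<iota> x y \<longleftrightarrow> (\<forall>S. is_subfield S \<and> range \<iota> \<subseteq> S \<and> x \<in> S \<and> y \<in> S \<longrightarrow> S = UNIV)"

definition transcendental_over :: "('f::field \<Rightarrow> 'K::field) \<Rightarrow> 'K \<Rightarrow> bool" where
  "transcendental_over \<iota> x \<longleftrightarrow> (\<forall>p::'f poly. p \<noteq> 0 \<longrightarrow> poly (map_poly \<iota> p) x \<noteq> 0)"

text \<open>Places of K/F_q, given by their normalized discrete valuations
(values at 0 are irrelevant).\<close>
definition is_place :: "('f::field \<Rightarrow> 'K::field) \<Rightarrow> ('K \<Rightarrow> int) \<Rightarrow> bool" where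
  "is_place \<iota> v \<longleftrightarrow>
     (\<forall>a b. a \<noteq> 0 \<longrightarrow> b \<noteq> 0 \<longrightarrow> v (a * b) = v a + v b) \<and>
     (\<forall>a b. a \<noteq> 0 \<longrightarrow> b \<noteq> 0 \<longrightarrow> a + b \<noteq> 0 \<longrightarrow> v (a + b) \<ge> min (v a) (v b)) \<and>
     (\<forall>c. c \<noteq> 0 \<longrightarrow> v (\<iota> c) = 0) \<and>
     (\<forall>n. \<exists>a. a \<noteq> 0 \<and> v a = n)"

text \<open>Degree-one (F_q-rational) places: residue field equals F_q.\<close>
definition is_rational_place :: "('f::field \<Rightarrow> 'K::field) \<Rightarrow> ('K \<Rightarrow> int) \<Rightarrow> bool" where
  "is_rational_place \<iota> v \<longleftrightarrow> is_place \<iota> v \<and>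
     (\<forall>f. f \<noteq> 0 \<longrightarrow> v f \<ge> 0 \<longrightarrow> (\<exists>c. f = \<iota> c \<or> (f - \<iota> c \<noteq> 0 \<and> v (f - \<iota> c) > 0)))"

definition RR_lD :: "('f::field \<Rightarrow> 'K::field) \<Rightarrow> nat \<Rightarrow> 'K set" where
  "RR_lD \<iota> l = {f. f = 0 \<or> (\<forall>v. is_place \<iota> v \<longrightarrow>
        v f \<ge> (if is_rational_place \<iota> v then - int l else 0))}"

definition lin_indep_over :: "('f::field \<Rightarrow> 'K::field) \<Rightarrow> 'K set \<Rightarrow> bool" where
  "lin_indep_over \<iota> S \<longleftrightarrow> (\<forall>T c. finite T \<and> T \<subseteq> S \<and> (\<Sum>s\<in>T. \<iota> (c s) * s) = 0 \<longrightarrow> (\<forall>s\<in>T. c s = 0))"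

definition span_over :: "('f::field \<Rightarrow> 'K::field) \<Rightarrow> 'K set \<Rightarrow> 'K set" where
  "span_over \<iota> S = {\<Sum>s\<in>T. \<iota> (c s) * s | T c. finite T \<and> T \<subseteq> S}"

definition basis_over :: "('f::field \<Rightarrow> 'K::field) \<Rightarrow> 'K set \<Rightarrow> 'K set \<Rightarrow> bool" where
  "basis_over \<iota> S V \<longleftrightarrow> lin_indep_over \<iota> S \<and> span_over \<iota> S = V"

end

theory Submission
  imports Defs "HOL-Computational_Algebra.Polynomial_Factorial"
begin

text \<open>
Multiplication by \<open>X ^ l\<close> with \<open>X = x ^ q + x\<close> turns \<open>\<L>(l D)\<close> into \<open>\<L>(l (q\<^sup>2 + 1) P\<^sub>\<infinity>)\<close>, because
\<open>X\<close> has a simple zero at each affine rational point and a pole of order \<open>q\<^sup>2\<close> at \<open>P\<^sub>\<infinity>\<close>. The monomials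
\<open>x ^ a * y ^ b * z ^ c * w ^ d * X ^ s\<close> with \<open>a < q\<close>, \<open>b \<le> 1\<close>, \<open>c, d < q\<^sub>0\<close> span the ring \<open>R\<close> generated by \<open>x\<close>
and \<open>y\<close>, and their pole orders at infinity are pairwise distinct; hence the elements of \<open>R\<close> of pole
order at most \<open>N\<close> have the monomials of pole order at most \<open>N\<close> as a basis. The bound \<open>l \<le> q\<^sup>2 - 1\<close> forces
\<open>s \<le> l\<close> for the monomials that occur.

It remains to see that a function without poles at the finite places lies in \<open>R\<close>. For an irreducible
\<open>p(x)\<close>, some power of the Frobenius fixes \<open>R / p R\<close> pointwise. So \<open>R / p R\<close> is reduced, and \<open>p\<close> is a
uniformizer of every valuation ring that contains \<open>R\<close> and has \<open>p\<close> in its maximal ideal. Valuation rings,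
finite and infinite, exist by Chevalley's extension theorem. If \<open>B h = g\<close> lies in \<open>R\<close> with \<open>B\<close> of minimal
degree and \<open>p\<close> divides \<open>B\<close>, then \<open>g\<close> is not in \<open>p R\<close>, and a valuation ring containing \<open>R[1/g]\<close> but not
\<open>1/p\<close> exhibits a pole of \<open>h\<close>.
\<close>


section \<open>Valuation rings\<close>

definition subring_of_field :: "'K::field set \<Rightarrow> bool" where
  "subring_of_field A \<longleftrightarrow> 1 \<in> A \<and> (\<forall>a\<in>A. \<forall>b\<in>A. a - b \<in> A \<and> a * b \<in> A)"

lemma subring_of_fieldD:
  assumes "subring_of_field A"
  shows "0 \<in> A" "1 \<in> A"
    "\<And>a. a \<in> A \<Longrightarrow> - a \<in> A"
    "\<And>a b. a \<in> A \<Longrightarrow> b \<in> A \<Longrightarrow> a - b \<in> A"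
    "\<And>a b. a \<in> A \<Longrightarrow> b \<in> A \<Longrightarrow> a * b \<in> A"
    "\<And>a b. a \<in> A \<Longrightarrow> b \<in> A \<Longrightarrow> a + b \<in> A"
    "\<And>a n. a \<in> A \<Longrightarrow> a ^ n \<in> A"
proof -
  note A = assms[unfolded subring_of_field_def]
  show zero: "0 \<in> A" using A by (metis diff_self)
  show "1 \<in> A" using A by blast
  show neg: "- a \<in> A" if "a \<in> A" for a using A zero that by (metis diff_0)
  show "a - b \<in> A" "a * b \<in> A" if "a \<in> A" "b \<in> A" for a b using A that by blast+
  show "a + b \<in> A" if "a \<in> A" "b \<in> A" for a b using A neg that by (metis diff_minus_eq_add)
  show "a ^ n \<in> A" if "a \<in> A" for a n using A that by (induction n) auto
qed

locale valuation_ring =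
  fixes V :: "'K::field set"
  assumes subring: "subring_of_field V"
    and total: "\<And>f. f \<in> V \<or> inverse f \<in> V"
begin

lemmas ring_closed = subring_of_fieldD[OF subring]

definition vunit :: "'K set" where "vunit = {f. f \<noteq> 0 \<and> f \<in> V \<and> inverse f \<in> V}"

definition vmax :: "'K set" where "vmax = V - vunit"

lemma vunit_subset: "f \<in> vunit \<Longrightarrow> f \<in> V" and vmax_subset: "f \<in> vmax \<Longrightarrow> f \<in> V"
  by (auto simp: vunit_def vmax_def)

lemma vunit_nonzero: "f \<in> vunit \<Longrightarrow> f \<noteq> 0"
  by (auto simp: vunit_def)

lemma vmax_not_vunit: "f \<in> vmax \<Longrightarrow> f \<notin> vunit"
  by (auto simp: vmax_def)

text \<open>Zero is listed separately because \<open>inverse 0 = 0\<close> lies in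
  \<open>V\<close>.\<close>

lemma vmax_iff: "f \<in> vmax \<longleftrightarrow> f = 0 \<or> inverse f \<notin> V"
  using total[of f] ring_closed(1) by (auto simp: vmax_def vunit_def)

lemma one_in_vunit: "1 \<in> vunit"
  using ring_closed(2) by (simp add: vunit_def)

lemma vunit_mult: "f \<in> vunit \<Longrightarrow> g \<in> vunit \<Longrightarrow> f * g \<in> vunit"
  using ring_closed(5) by (auto simp: vunit_def)

lemma vunit_inverse: "f \<in> vunit \<Longrightarrow> inverse f \<in> vunit"
  by (auto simp: vunit_def)

lemma vunit_divide: "f \<in> vunit \<Longrightarrow> g \<in> vunit \<Longrightarrow> f / g \<in> vunit"
  by (simp add: divide_inverse vunit_mult vunit_inverse)

lemma vunit_power: "f \<in> vunit \<Longrightarrow> f ^ n \<in> vunit"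
  by (induction n) (auto simp: one_in_vunit vunit_mult)

lemma vmax_mult: "f \<in> V \<Longrightarrow> g \<in> vmax \<Longrightarrow> f * g \<in> vmax"
proof -
  assume f: "f \<in> V" and g: "g \<in> vmax"
  have "inverse g \<in> V" if "f * g \<noteq> 0" "inverse (f * g) \<in> V"
  proof -
    have "inverse g = f * inverse (f * g)" using that by (simp add: field_simps)
    then show ?thesis using ring_closed(5)[OF f that(2)] by (simp only:)
  qed
  then show ?thesis using g unfolding vmax_iff by auto
qed

text \<open>By totality \<open>f / g\<close> or \<open>g / f\<close> lies in \<open>V\<close>, so
  the sum is an element of \<open>V\<close> times one of the two summands.\<close>

lemma vmax_add: "f \<in> vmax \<Longrightarrow> g \<in> vmax \<Longrightarrow> f + g \<in> vmax"
proof -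
  have aux: "f + g \<in> vmax" if f: "f \<in> vmax" and g: "g \<in> vmax" and "f / g \<in> V" "g \<noteq> 0" for f g
  proof -
    have "f + g = (f / g + 1) * g" using that by (simp add: field_simps)
    then show ?thesis using vmax_mult[of "f / g + 1" g] ring_closed(2,6) that by simp
  qed
  assume f: "f \<in> vmax" and g: "g \<in> vmax"
  show ?thesis
  proof (cases "f = 0 \<or> g = 0")
    case True then show ?thesis using f g by auto
  next
    case False
    have "f / g \<in> V \<or> g / f \<in> V" using total[of "f / g"] by simp
    then show ?thesis using aux[OF f g] aux[OF g f] False by (auto simp: add.commute)
  qed
qed

lemma vmax_uminus: "f \<in> vmax \<Longrightarrow> - f \<in> vmax"
  using vmax_mult[of "-1" f] ring_closed(2,3) by simp

lemma vmax_diff: "f \<in> vmax \<Longrightarrow> g \<in> vmax \<Longrightarrow> f - g \<in> vmax"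
  using vmax_add[of f "- g"] vmax_uminus by simp

lemma vunit_add_vmax: "f \<in> vunit \<Longrightarrow> g \<in> vmax \<Longrightarrow> f + g \<in> vunit"
proof (rule ccontr)
  assume fg: "f \<in> vunit" "g \<in> vmax" "f + g \<notin> vunit"
  then have "f + g \<in> vmax"
    using ring_closed(6) vmax_subset vunit_subset by (auto simp: vmax_def)
  from vmax_diff[OF this fg(2)] show False using fg vmax_not_vunit by auto
qed

text \<open>A special case of integral closedness: if \<open>inverse f\<close> lies in
  \<open>V\<close>, then \<open>f = f ^ n * inverse f ^ (n - 1)\<close> is a product of elements of
  \<open>V\<close>.\<close>

lemma power_in_V_imp: "f ^ n \<in> V \<Longrightarrow> n > 0 \<Longrightarrow> f \<in> V"
proof (rule ccontr)
  assume fn: "f ^ n \<in> V" "n > 0" and "f \<notin> V"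
  then have inv: "inverse f \<in> V" and "f \<noteq> 0" using total ring_closed(1) by auto
  have "f = f ^ n * inverse f ^ (n - 1)"
    using fn \<open>f \<noteq> 0\<close> by (cases n) (auto simp: field_simps)
  then show False using ring_closed(5,7) fn inv \<open>f \<notin> V\<close> by metis
qed

lemma power_in_vunit_iff:
  assumes "n > 0"
  shows "f ^ n \<in> vunit \<longleftrightarrow> f \<in> vunit"
proof
  assume fn: "f ^ n \<in> vunit"
  then have "inverse f ^ n \<in> V" by (simp add: vunit_def power_inverse)
  then have "inverse f \<in> V" using assms by (rule power_in_V_imp)
  moreover have "f \<in> V" using vunit_subset[OF fn] assms by (rule power_in_V_imp)
  moreover have "f \<noteq> 0" using vunit_nonzero[OF fn] assms by auto
  ultimately show "f \<in> vunit" by (simp add: vunit_def)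
qed (rule vunit_power)

lemma power_in_vmax_iff:
  assumes "n > 0"
  shows "f ^ n \<in> vmax \<longleftrightarrow> f \<in> vmax"
  unfolding vmax_def using power_in_V_imp[OF _ assms] power_in_vunit_iff[OF assms] ring_closed(7)
  by blast

lemma inverse_in_vmax: "f \<notin> V \<Longrightarrow> inverse f \<in> vmax"
  by (simp add: vmax_iff)

text \<open>No nonzero power of \<open>\<pi>\<close> is a unit, so the exponent provided by
  \<open>unif\<close> is unique. It defines the valuation, which is normalized because
  \<open>\<pi> powi n\<close> has value \<open>n\<close>.\<close>

lemma uniformizer_imp_place:
  assumes iota: "is_field_hom \<iota>" "range \<iota> \<subseteq> V"
    and pi: "\<pi> \<in> vmax" "\<pi> \<noteq> 0"
    and unif: "\<And>f. f \<noteq> 0 \<Longrightarrow> \<exists>n::int. f / \<pi> powi n \<in> vunit"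
  obtains v where "is_place \<iota> v" "v \<pi> = 1" "\<And>f. f \<noteq> 0 \<Longrightarrow> 0 \<le> v f \<longleftrightarrow> f \<in> V"
proof -
  have pow: "\<pi> powi n \<in> V \<longleftrightarrow> n \<ge> 0" "\<pi> powi n \<in> vunit \<longleftrightarrow> n = 0" for n
  proof -
    have 1: "\<pi> powi n \<in> V" if "n \<ge> 0" for n
      using that ring_closed(7) vmax_subset[OF pi(1)] by (simp add: power_int_def)
    have 2: "\<pi> powi n \<in> vmax" if "n > 0" for n
      using that pi power_in_vmax_iff[of "nat n" \<pi>] by (simp add: power_int_def)
    have 3: "\<pi> powi n \<notin> V" if "n < 0" for n
      using 2[of "- n"] that pi by (auto simp: vmax_iff power_int_minus)
    show "\<pi> powi n \<in> V \<longleftrightarrow> n \<ge> 0" using 1 3 by (meson linorder_not_le)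
    show "\<pi> powi n \<in> vunit \<longleftrightarrow> n = 0"
      using 2[of n] 3[of n] one_in_vunit vmax_not_vunit vunit_subset
      by (cases n "0::int" rule: linorder_cases) auto
  qed
  \<comment> \<open>At 0 no exponent qualifies and the value is arbitrary; \<open>is_place\<close>
    puts no condition on it.\<close>
  define v where "v f = (SOME n. f / \<pi> powi n \<in> vunit)" for f
  have v: "f / \<pi> powi v f \<in> vunit" if "f \<noteq> 0" for f
    unfolding v_def using unif[OF that] by (rule someI_ex)
  have v_eq: "v f = n" if "f / \<pi> powi n \<in> vunit" for f n
  proof -
    have "f \<noteq> 0" using vunit_nonzero[OF that] by auto
    then have "(f / \<pi> powi n) / (f / \<pi> powi v f) = \<pi> powi (v f - n)"
      using pi by (simp add: power_int_diff field_simps)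
    then have "\<pi> powi (v f - n) \<in> vunit" using vunit_divide[OF that v[OF \<open>f \<noteq> 0\<close>]] by simp
    then show ?thesis using pow by simp
  qed
  have V_iff: "0 \<le> v f \<longleftrightarrow> f \<in> V" if "f \<noteq> 0" for f
  proof
    assume "0 \<le> v f"
    then have "f / \<pi> powi v f * \<pi> powi v f \<in> V"
      using pow v[OF that] ring_closed(5) vunit_subset by blast
    then show "f \<in> V" using pi by simp
  next
    assume "f \<in> V"
    then have "f * inverse (f / \<pi> powi v f) \<in> V"
      using v[OF that] ring_closed(5) vunit_inverse vunit_subset by blast
    moreover have "f * inverse (f / \<pi> powi v f) = \<pi> powi v f" using that by simp
    ultimately show "0 \<le> v f" using pow by simp
  qed
  have mult: "v (a * b) = v a + v b" if "a \<noteq> 0" "b \<noteq> 0" for a b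
  proof (rule v_eq)
    have "a * b / \<pi> powi (v a + v b) = (a / \<pi> powi v a) * (b / \<pi> powi v b)"
      using pi by (simp add: power_int_add)
    then show "a * b / \<pi> powi (v a + v b) \<in> vunit"
      using vunit_mult[OF v[OF that(1)] v[OF that(2)]] by (simp only:)
  qed
  have powi: "v (\<pi> powi n) = n" for n
    by (rule v_eq) (use pi one_in_vunit in auto)
  have add: "v (a + b) \<ge> min (v a) (v b)" if "a \<noteq> 0" "b \<noteq> 0" "a + b \<noteq> 0" for a b
  proof -
    \<comment> \<open>Division by \<open>\<pi> powi k\<close> moves both summands into
      \<open>V\<close>, where closure under addition gives the ultrametric inequality.\<close>
    define k where "k = min (v a) (v b)"
    have *: "c / \<pi> powi k \<in> V" if "c \<noteq> 0" "v c \<ge> k" for c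
    proof -
      have "v (c * \<pi> powi (- k)) = v c - k" using mult[of c "\<pi> powi (- k)"] powi that pi by simp
      then show ?thesis using V_iff[of "c * \<pi> powi (- k)"] that pi
        by (simp add: power_int_minus divide_inverse)
    qed
    have "(a + b) / \<pi> powi k \<in> V"
      using ring_closed(6)[OF *[of a] *[of b]] that by (simp add: k_def add_divide_distrib)
    then have "0 \<le> v ((a + b) * \<pi> powi (- k))"
      using V_iff[of "(a + b) * \<pi> powi (- k)"] that pi by (simp add: power_int_minus divide_inverse)
    also have "\<dots> = v (a + b) - k" using mult[of "a + b" "\<pi> powi (- k)"] powi that pi by simp
    finally show ?thesis by (simp add: k_def)
  qed
  have const: "v (\<iota> c) = 0" if "c \<noteq> 0" for c
  proof (rule v_eq)
    have "\<iota> c * \<iota> (inverse c) = 1"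
      using iota(1) that unfolding is_field_hom_def by (metis right_inverse)
    then have "\<iota> c \<noteq> 0" "inverse (\<iota> c) = \<iota> (inverse c)" by (auto simp: inverse_unique)
    then show "\<iota> c / \<pi> powi 0 \<in> vunit" using iota(2) by (auto simp: vunit_def)
  qed
  have "is_place \<iota> v"
    unfolding is_place_def using mult add const powi pi by (metis power_int_eq_0_iff)
  moreover have "v \<pi> = 1" using powi[of 1] by simp
  ultimately show ?thesis using that V_iff by blast
qed

end

subsection \<open>Existence of valuation rings\<close>

text \<open>Values at \<open>f\<close> of polynomials over \<open>B\<close> of degree at most
  \<open>n\<close>, in Horner form. The union over \<open>n\<close> is the ring B[f]; the degree is
  recorded because the proof of Chevalley's theorem descends on it.\<close>

primrec poly_span :: "'K::field set \<Rightarrow> 'K \<Rightarrow> nat \<Rightarrow> 'K set" where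
  "poly_span B f 0 = B"
| "poly_span B f (Suc n) = {b + f * u | b u. b \<in> B \<and> u \<in> poly_span B f n}"

context
  fixes B :: "'K::field set" and f :: 'K
  assumes B: "subring_of_field B"
begin

lemma poly_span_base: "b \<in> B \<Longrightarrow> b \<in> poly_span B f n"
proof (induction n arbitrary: b)
  case (Suc n)
  then have "b = b + f * 0" "0 \<in> poly_span B f n" using subring_of_fieldD(1)[OF B] by auto
  then show ?case using Suc.prems by force
qed simp

lemma poly_span_add: "u \<in> poly_span B f n \<Longrightarrow> u' \<in> poly_span B f n \<Longrightarrow> u + u' \<in> poly_span B f n"
proof (induction n arbitrary: u u')
  case (Suc n)
  then obtain b s b' s' where "u = b + f * s" "b \<in> B" "s \<in> poly_span B f n"
     "u' = b' + f * s'" "b' \<in> B" "s' \<in> poly_span B f n" by auto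
  then have "u + u' = (b + b') + f * (s + s')" "b + b' \<in> B" "s + s' \<in> poly_span B f n"
    using Suc.IH subring_of_fieldD(6)[OF B] by (auto simp: algebra_simps)
  then show ?case by auto
qed (use subring_of_fieldD[OF B] in auto)

lemma poly_span_scale: "c \<in> B \<Longrightarrow> u \<in> poly_span B f n \<Longrightarrow> c * u \<in> poly_span B f n"
proof (induction n arbitrary: u)
  case (Suc n)
  then obtain b s where "u = b + f * s" "b \<in> B" "s \<in> poly_span B f n" by auto
  then have "c * u = c * b + f * (c * s)" "c * b \<in> B" "c * s \<in> poly_span B f n"
    using Suc.IH Suc.prems(1) subring_of_fieldD(5)[OF B] by (auto simp: distrib_left mult.left_commute)
  then show ?case by auto
qed (use subring_of_fieldD[OF B] in auto)

lemma poly_span_times: "u \<in> poly_span B f n \<Longrightarrow> f * u \<in> poly_span B f (Suc n)"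
  using subring_of_fieldD(1)[OF B] by force

lemma poly_span_times_power: "u \<in> poly_span B f n \<Longrightarrow> f ^ k * u \<in> poly_span B f (k + n)"
proof (induction k)
  case (Suc k)
  then have "f * (f ^ k * u) \<in> poly_span B f (Suc (k + n))" by (intro poly_span_times) auto
  then show ?case by (simp only: power_Suc mult.assoc add_Suc)
qed simp

lemma poly_span_mono_Suc: "u \<in> poly_span B f n \<Longrightarrow> u \<in> poly_span B f (Suc n)"
proof (induction n arbitrary: u)
  case 0 then show ?case using poly_span_base[of u "Suc 0"] by simp
next
  case (Suc n)
  then obtain b s where "u = b + f * s" "b \<in> B" "s \<in> poly_span B f n" by auto
  with Suc.IH[of s] show ?case by (subst poly_span.simps) blast
qed

lemma poly_span_mono: "u \<in> poly_span B f n \<Longrightarrow> n \<le> k \<Longrightarrow> u \<in> poly_span B f k"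
  by (rotate_tac 1, induction k rule: dec_induct) (auto intro: poly_span_mono_Suc simp del: poly_span.simps)

text \<open>Horner form exposes only the constant coefficient; lowering the degree of a
  representation needs the leading one.\<close>

lemma poly_span_top:
  "u \<in> poly_span B f (Suc n) \<Longrightarrow> \<exists>a\<in>B. \<exists>s\<in>poly_span B f n. u = s + a * f ^ Suc n"
proof (induction n arbitrary: u)
  case 0 then show ?case by (auto simp: mult.commute)
next
  case (Suc n)
  from Suc.prems obtain b s where u: "u = b + f * s" "b \<in> B" "s \<in> poly_span B f (Suc n)"
    by (subst (asm) poly_span.simps(2)) blast
  from Suc.IH[OF u(3)] obtain a s' where s': "a \<in> B" "s' \<in> poly_span B f n" "s = s' + a * f ^ Suc n"
    by blast
  have "u = (b + f * s') + a * f ^ Suc (Suc n)" using u s' by (simp add: algebra_simps)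
  moreover have "b + f * s' \<in> poly_span B f (Suc n)" using u s' by auto
  ultimately show ?case using s' by blast
qed

lemma poly_span_mult:
  "u \<in> poly_span B f n \<Longrightarrow> u' \<in> poly_span B f k \<Longrightarrow> u * u' \<in> poly_span B f (n + k)"
proof (induction n arbitrary: u)
  case 0 then show ?case by (simp add: poly_span_scale)
next
  case (Suc n)
  then obtain b s where u: "u = b + f * s" "b \<in> B" "s \<in> poly_span B f n" by auto
  have "b * u' \<in> poly_span B f (Suc n + k)"
    using poly_span_mono[OF poly_span_scale[OF u(2) Suc.prems(2)]] by (simp del: poly_span.simps)
  moreover have "f * (s * u') \<in> poly_span B f (Suc n + k)"
    using poly_span_times[OF Suc.IH[OF u(3) Suc.prems(2)]] by (simp del: poly_span.simps)
  ultimately show ?case using poly_span_add[of "b * u'" "Suc n + k" "f * (s * u')"] u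
    by (simp add: algebra_simps del: poly_span.simps)
qed

lemma subring_poly_span: "subring_of_field (\<Union>n. poly_span B f n)"
  unfolding subring_of_field_def
proof (intro conjI ballI)
  show "1 \<in> (\<Union>n. poly_span B f n)" using poly_span_base subring_of_fieldD(2)[OF B] by blast
  fix a b assume "a \<in> (\<Union>n. poly_span B f n)" "b \<in> (\<Union>n. poly_span B f n)"
  then obtain n k where a: "a \<in> poly_span B f n" and b: "b \<in> poly_span B f k" by blast
  show "a * b \<in> (\<Union>n. poly_span B f n)" using poly_span_mult[OF a b] by blast
  have "-1 \<in> B" using subring_of_fieldD[OF B] by blast
  from poly_span_scale[OF this b] have "- b \<in> poly_span B f k" by simp
  then have "a + - b \<in> poly_span B f (max n k)"
    using a by (intro poly_span_add) (auto elim: poly_span_mono)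
  then show "a - b \<in> (\<Union>n. poly_span B f n)" by auto
qed

end

text \<open>Clearing denominators: multiplication by \<open>f ^ n\<close> reverses the coefficients
  of a polynomial in \<open>inverse f\<close>.\<close>

lemma poly_span_inverse:
  assumes B: "subring_of_field B" and "f \<noteq> 0"
  shows "u \<in> poly_span B (inverse f) n \<Longrightarrow> f ^ n * u \<in> poly_span B f n"
proof (induction n arbitrary: u)
  case (Suc n)
  then obtain b s where u: "u = b + inverse f * s" "b \<in> B" "s \<in> poly_span B (inverse f) n" by auto
  have "f ^ Suc n * u = b * f ^ Suc n + f ^ n * s"
    unfolding u(1) using \<open>f \<noteq> 0\<close> by (simp add: field_simps)
  moreover have "f ^ Suc n * b \<in> poly_span B f (Suc n + 0)"
    using u by (intro poly_span_times_power[OF B]) auto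
  moreover have "f ^ n * s \<in> poly_span B f (Suc n)"
    using Suc.IH[OF u(3)] poly_span_mono_Suc[OF B] by blast
  ultimately show ?case using poly_span_add[OF B] by (simp add: mult.commute del: poly_span.simps)
qed simp

text \<open>Chevalley's extension theorem: a subring maximal among those not containing \<open>inverse s\<close> is a
valuation ring.\<close>
theorem exists_valuation_ring:
  fixes A :: "'K::field set"
  assumes A: "subring_of_field A" and s: "s \<in> A" "inverse s \<notin> A"
  obtains V where "valuation_ring V" "A \<subseteq> V" "inverse s \<notin> V"
proof -
  define F where "F = {B. subring_of_field B \<and> A \<subseteq> B \<and> inverse s \<notin> B}"
  have "\<exists>M\<in>F. \<forall>X\<in>F. M \<subseteq> X \<longrightarrow> X = M"
  proof (rule subset_Zorn_nonempty)
    show "F \<noteq> {}" using assms by (auto simp: F_def)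
    fix C assume C: "C \<noteq> {}" "subset.chain F C"
    have CF: "B \<in> F" if "B \<in> C" for B using C that by (auto simp: subset_chain_def)
    have "subring_of_field (\<Union>C)"
      unfolding subring_of_field_def
    proof (intro conjI ballI)
      show "1 \<in> \<Union>C" using C CF subring_of_fieldD(2) by (fastforce simp: F_def)
      fix a b assume "a \<in> \<Union>C" "b \<in> \<Union>C"
      then obtain B B' where BB: "a \<in> B" "b \<in> B'" "B \<in> C" "B' \<in> C" by blast
      then obtain B'' where "B'' \<in> C" "a \<in> B''" "b \<in> B''"
        using C(2) by (metis subset_chain_def subsetD)
      then show "a - b \<in> \<Union>C" "a * b \<in> \<Union>C"
        using CF subring_of_fieldD(4,5) unfolding F_def by blast+
    qed
    then show "\<Union>C \<in> F" using C CF by (fastforce simp: F_def)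
  qed
  then obtain B where BF: "B \<in> F" and max: "\<And>X. X \<in> F \<Longrightarrow> B \<subseteq> X \<Longrightarrow> X = B" by blast
  have B: "subring_of_field B" and AB: "A \<subseteq> B" and sB: "inverse s \<notin> B" using BF by (auto simp: F_def)
  note Bc = subring_of_fieldD[OF B]
  have s0: "s \<noteq> 0" using s by auto
  have s_in: "s \<in> B" using s AB by blast
  \<comment> \<open>Maximality of \<open>B\<close>: the ring B[f] is strictly larger, so it must
    contain \<open>inverse s\<close>.\<close>
  have meets: "\<exists>n. inverse s \<in> poly_span B f n" if "f \<notin> B" for f
  proof (rule ccontr)
    assume contra: "\<nexists>n. inverse s \<in> poly_span B f n"
    have sub: "B \<subseteq> (\<Union>n. poly_span B f n)" using poly_span_base[OF B] by blast
    have "(\<Union>n. poly_span B f n) \<in> F"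
      using contra sub AB subring_poly_span[OF B] by (auto simp: F_def)
    then have "(\<Union>n. poly_span B f n) = B" using max sub by blast
    moreover have "f \<in> poly_span B f (Suc 0)" using poly_span_times[OF B, of 1 f 0] Bc(2) by simp
    ultimately show False using that by blast
  qed
  \<comment> \<open>So \<open>s\<close> lies in the Jacobson radical of \<open>B\<close>. Otherwise
    \<open>inverse s\<close> is a polynomial in the inverse of \<open>?u = 1 - s * b\<close>, hence
    \<open>?u ^ n * inverse s\<close> is in \<open>B\<close> for some \<open>n\<close>. As
    \<open>?u ^ n\<close> is 1 modulo \<open>s\<close>, this puts \<open>inverse s\<close> itself
    into \<open>B\<close>.\<close>
  have unit: "inverse (1 - s * b) \<in> B" if b: "b \<in> B" for b
  proof (rule ccontr)
    let ?u = "1 - s * b"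
    assume "inverse ?u \<notin> B"
    then obtain n where "inverse s \<in> poly_span B (inverse ?u) n" using meets by blast
    moreover have "?u \<noteq> 0"
    proof
      assume "?u = 0" then have "inverse s = b" using s0 by (simp add: field_simps)
      then show False using sB b by simp
    qed
    ultimately have "?u ^ n * inverse s \<in> poly_span B ?u n" by (intro poly_span_inverse[OF B])
    moreover have uB: "?u \<in> B" by (intro Bc(2,4,5) s_in b)
    have "poly_span B ?u k \<subseteq> B" for k
      by (induction k) (use uB Bc in auto)
    ultimately have mem: "?u ^ n * inverse s \<in> B" by blast
    have "\<exists>c\<in>B. ?u ^ k = 1 - s * c" for k
    proof (induction k)
      case 0 show ?case using Bc by (intro bexI[of _ 0]) auto
    next
      case (Suc k)
      then obtain c where c: "c \<in> B" "?u ^ k = 1 - s * c" by blast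
      have "?u ^ Suc k = 1 - s * (b + c - s * b * c)" by (simp only: power_Suc c) algebra
      moreover have "b + c - s * b * c \<in> B" by (intro Bc(4,5,6) s_in b c)
      ultimately show ?case by blast
    qed
    then obtain c where c: "c \<in> B" "?u ^ n = 1 - s * c" by blast
    have "?u ^ n * inverse s + c = inverse s" using s0 unfolding c by (simp add: field_simps)
    then show False using sB Bc(6)[OF mem c(1)] by simp
  qed
  \<comment> \<open>The constant coefficient \<open>b\<close> of the expansion in
    \<open>inverse f\<close> gives a unit \<open>1 - s * b\<close>, and solving for \<open>f\<close>
    followed by multiplication with \<open>f ^ k\<close> writes \<open>f ^ Suc k\<close> as a
    polynomial in \<open>f\<close> of degree at most \<open>k\<close>. As \<open>k \<le> n\<close>,
    the leading term of the expansion in \<open>f\<close> can be replaced by terms of lower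
    degree.\<close>
  have descend: "inverse s \<in> poly_span B f n"
    if f: "f \<noteq> 0" and k: "inverse s \<in> poly_span B (inverse f) (Suc k)" "k \<le> n"
      and n: "inverse s \<in> poly_span B f (Suc n)" for f k n
  proof -
    from k obtain b u where bu: "inverse s = b + inverse f * u" "b \<in> B" "u \<in> poly_span B (inverse f) k"
      by auto
    have mult_eq: "(1 - s * b) * f = s * u"
    proof -
      have "s * inverse s = s * (b + inverse f * u)" using bu by simp
      then show ?thesis using s0 f by (simp add: field_simps)
    qed
    have "1 - s * b \<noteq> 0"
    proof
      assume "1 - s * b = 0" then have "inverse s = b" using s0 by (simp add: field_simps)
      then show False using sB bu(2) by simp
    qed
    then have "f = inverse (1 - s * b) * ((1 - s * b) * f)" by simp
    then have f_eq: "f = inverse (1 - s * b) * s * u" by (simp only: mult_eq mult.assoc)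
    have "f ^ k * u \<in> poly_span B f k" using bu f by (intro poly_span_inverse[OF B])
    moreover have "inverse (1 - s * b) * s \<in> B" by (intro Bc(5) unit bu s_in)
    ultimately have "inverse (1 - s * b) * s * (f ^ k * u) \<in> poly_span B f k"
      by (rule poly_span_scale[OF B, rotated])
    also have "inverse (1 - s * b) * s * (f ^ k * u) = f ^ k * (inverse (1 - s * b) * s * u)"
      by (simp only: mult.left_commute mult.assoc)
    also have "\<dots> = f ^ Suc k"
      by (simp only: f_eq[symmetric] power_Suc2)
    finally have "f ^ (n - k) * f ^ Suc k \<in> poly_span B f (n - k + k)"
      by (rule poly_span_times_power[OF B])
    then have top: "f ^ Suc n \<in> poly_span B f n"
      using k(2) by (simp flip: power_add del: power_Suc)
    from poly_span_top[OF B n] obtain a u' where au: "a \<in> B" "u' \<in> poly_span B f n"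
      "inverse s = u' + a * f ^ Suc n" by blast
    show ?thesis unfolding au(3)
      by (intro poly_span_add[OF B] poly_span_scale[OF B] top au)
  qed
  \<comment> \<open>Of the two expansions, one whose degree is not the smaller can always be
    shortened. A degree of 0 would mean that \<open>inverse s\<close> lies in
    \<open>B\<close>.\<close>
  have no_reps: False if "f \<noteq> 0" "inverse s \<in> poly_span B (inverse f) k" "inverse s \<in> poly_span B f n" for f n k
    using that
  proof (induction "n + k" arbitrary: n k f rule: less_induct)
    case less
    obtain n' k' where nk: "n = Suc n'" "k = Suc k'"
      using less.prems sB by (cases n; cases k) auto
    show ?case
    proof (cases "k' \<le> n'")
      case True
      then have "inverse s \<in> poly_span B f n'" using descend less.prems nk by blast
      then show ?thesis using less.hyps[of n' k f] less.prems nk by auto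
    next
      case False
      then have "inverse s \<in> poly_span B (inverse f) k'"
        using descend[of "inverse f" n' k'] less.prems nk by simp
      then show ?thesis using less.hyps[of n k' f] less.prems nk by auto
    qed
  qed
  have "valuation_ring B"
  proof
    show "f \<in> B \<or> inverse f \<in> B" for f
      using meets[of f] meets[of "inverse f"] no_reps[of f] Bc(1) by (cases "f = 0") auto
  qed (rule B)
  then show ?thesis using that AB sB by blast
qed


section \<open>Places\<close>

lemma is_field_homD:
  assumes "is_field_hom \<iota>"
  shows "\<iota> 0 = 0" "\<iota> 1 = 1" "\<iota> (a + b) = \<iota> a + \<iota> b" "\<iota> (a * b) = \<iota> a * \<iota> b"
    "\<iota> (- a) = - \<iota> a" "\<iota> (a - b) = \<iota> a - \<iota> b" "\<iota> (a ^ n) = \<iota> a ^ n"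
    "\<iota> a = 0 \<longleftrightarrow> a = 0"
proof -
  note hom = assms[unfolded is_field_hom_def]
  show zero: "\<iota> 0 = 0" using hom by (metis add_0 add_cancel_right_left)
  show one: "\<iota> 1 = 1" and add: "\<iota> (a + b) = \<iota> a + \<iota> b" and mult: "\<iota> (a * b) = \<iota> a * \<iota> b" for a b
    using hom by blast+
  show neg: "\<iota> (- a) = - \<iota> a" for a using add[of "- a" a] zero by (simp add: eq_neg_iff_add_eq_0)
  show "\<iota> (a - b) = \<iota> a - \<iota> b" using add[of a "- b"] neg by simp
  show "\<iota> (a ^ n) = \<iota> a ^ n" by (induction n) (auto simp: one mult)
  show "\<iota> a = 0 \<longleftrightarrow> a = 0" using mult[of a "inverse a"] zero one by (cases "a = 0") auto
qed

text \<open>Treats 0 as having infinite valuation, since the value \<open>v 0\<close> of a place is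
  arbitrary.\<close>

definition val_ge :: "('K::field \<Rightarrow> int) \<Rightarrow> 'K \<Rightarrow> int \<Rightarrow> bool" where
  "val_ge v f n \<longleftrightarrow> f = 0 \<or> n \<le> v f"

locale place =
  fixes \<iota> :: "'f::field \<Rightarrow> 'K::field" and v :: "'K \<Rightarrow> int"
  assumes hom: "is_field_hom \<iota>" and place: "is_place \<iota> v"
begin

lemma val_mult: "a \<noteq> 0 \<Longrightarrow> b \<noteq> 0 \<Longrightarrow> v (a * b) = v a + v b"
  using place unfolding is_place_def by blast

lemma val_const: "c \<noteq> 0 \<Longrightarrow> v (\<iota> c) = 0"
  using place unfolding is_place_def by blast

lemma val_surj: "\<exists>a. a \<noteq> 0 \<and> v a = n"
  using place unfolding is_place_def by blast

lemma val_one: "v 1 = 0"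
  using val_const[of 1] is_field_homD[OF hom] by simp

lemma val_minus: "v (- a) = v a"
proof (cases "a = 0")
  case False
  have "v (\<iota> (-1)) = 0" by (rule val_const) simp
  then have "v (-1) = 0" by (simp only: is_field_homD[OF hom])
  then show ?thesis using val_mult[of "-1" a] False by simp
qed simp

lemma val_inverse: "a \<noteq> 0 \<Longrightarrow> v (inverse a) = - v a"
  using val_mult[of a "inverse a"] val_one by simp

lemma val_divide: "a \<noteq> 0 \<Longrightarrow> b \<noteq> 0 \<Longrightarrow> v (a / b) = v a - v b"
  using val_mult[of a "inverse b"] val_inverse by (simp add: divide_inverse)

lemma val_power: "a \<noteq> 0 \<Longrightarrow> v (a ^ n) = int n * v a"
  by (induction n) (auto simp: val_one val_mult algebra_simps)

lemma val_powi: "a \<noteq> 0 \<Longrightarrow> v (a powi n) = n * v a"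
  by (auto simp: power_int_def val_power val_inverse simp flip: power_inverse)

lemma val_prod: "finite I \<Longrightarrow> (\<And>i. i \<in> I \<Longrightarrow> f i \<noteq> 0) \<Longrightarrow> v (prod f I) = (\<Sum>i\<in>I. v (f i))"
  by (induction I rule: finite_induct) (auto simp: val_one val_mult)

lemma val_ge_add: "val_ge v a n \<Longrightarrow> val_ge v b n \<Longrightarrow> val_ge v (a + b) n"
proof -
  assume ab: "val_ge v a n" "val_ge v b n"
  have "a \<noteq> 0 \<longrightarrow> b \<noteq> 0 \<longrightarrow> a + b \<noteq> 0 \<longrightarrow> v (a + b) \<ge> min (v a) (v b)"
    using place unfolding is_place_def by blast
  with ab show ?thesis by (fastforce simp: val_ge_def)
qed

lemma val_ge_minus: "val_ge v a n \<Longrightarrow> val_ge v (- a) n"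
  by (auto simp: val_ge_def val_minus)

lemma val_ge_diff: "val_ge v a n \<Longrightarrow> val_ge v b n \<Longrightarrow> val_ge v (a - b) n"
  using val_ge_add[of a n "- b"] val_ge_minus by simp

lemma val_ge_mult: "val_ge v a n \<Longrightarrow> val_ge v b k \<Longrightarrow> val_ge v (a * b) (n + k)"
  unfolding val_ge_def by (cases "a = 0 \<or> b = 0") (auto simp: val_mult intro: add_mono)

lemma val_ge_const: "val_ge v (\<iota> c) 0"
  using val_const[of c] by (cases "c = 0") (auto simp: val_ge_def is_field_homD[OF hom])

lemma val_ge_scale: "val_ge v a n \<Longrightarrow> val_ge v (\<iota> c * a) n"
  using val_ge_mult[OF val_ge_const] by fastforce

lemma val_ge_sum: "(\<And>i. i \<in> I \<Longrightarrow> val_ge v (f i) n) \<Longrightarrow> val_ge v (sum f I) n"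
  by (induction I rule: infinite_finite_induct) (auto intro: val_ge_add simp: val_ge_def[of v 0])

lemma val_ge_mono: "val_ge v a n \<Longrightarrow> k \<le> n \<Longrightarrow> val_ge v a k"
  by (auto simp: val_ge_def)

lemma val_add_less:
  assumes "a \<noteq> 0" "val_ge v b (v a + 1)"
  shows "a + b \<noteq> 0" "v (a + b) = v a"
proof -
  show ne: "a + b \<noteq> 0"
  proof
    assume "a + b = 0" then have "a = - b" by (simp add: eq_neg_iff_add_eq_0)
    then show False using assms val_minus[of b] by (auto simp: val_ge_def)
  qed
  have "val_ge v (a + b) (v a)"
    by (intro val_ge_add) (use assms in \<open>auto simp: val_ge_def\<close>)
  moreover have "\<not> val_ge v (a + b) (v a + 1)"
    using val_ge_diff[OF _ assms(2), of "a + b"] assms(1) by (auto simp: val_ge_def)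
  ultimately show "v (a + b) = v a" using ne by (auto simp: val_ge_def)
qed

text \<open>The summand of least valuation cannot be cancelled by the others. This gives both linear
  independence and bounds on the single terms of a sum.\<close>

lemma val_sum_distinct:
  assumes "finite I" "I \<noteq> {}" "\<And>i. i \<in> I \<Longrightarrow> f i \<noteq> 0" "inj_on (\<lambda>i. v (f i)) I"
  shows "\<exists>j\<in>I. sum f I \<noteq> 0 \<and> v (sum f I) = v (f j) \<and> (\<forall>i\<in>I. i \<noteq> j \<longrightarrow> v (f j) < v (f i))"
proof -
  define k where "k = Min ((\<lambda>i. v (f i)) ` I)"
  have "k \<in> (\<lambda>i. v (f i)) ` I" using assms unfolding k_def by (intro Min_in) auto
  then obtain j where j: "j \<in> I" "v (f j) = k" by blast
  have less: "v (f j) < v (f i)" if "i \<in> I" "i \<noteq> j" for i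
  proof -
    have "k \<le> v (f i)" using assms that unfolding k_def by (intro Min_le) auto
    moreover have "v (f i) \<noteq> v (f j)" using assms(4) that j by (auto dest: inj_onD)
    ultimately show ?thesis using j by simp
  qed
  have sum: "sum f I = f j + sum f (I - {j})" using assms(1) j by (simp add: sum.remove)
  have "val_ge v (sum f (I - {j})) (v (f j) + 1)"
    by (intro val_ge_sum) (use less in \<open>force simp: val_ge_def\<close>)
  from val_add_less[OF assms(3)[OF j(1)] this] show ?thesis
    unfolding sum using j less by blast
qed

text \<open>Makes the results on valuation rings available for a given place; the next two lemmas
  translate units and the maximal ideal back into values of \<open>v\<close>.\<close>

lemma valuation_ring_of_place: "valuation_ring {f. val_ge v f 0}"
proof
  show "subring_of_field {f. val_ge v f 0}"
    unfolding subring_of_field_def using val_ge_diff val_ge_mult[where n = 0 and k = 0]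
    by (auto simp: val_ge_def[of v 1] val_one)
  show "f \<in> {f. val_ge v f 0} \<or> inverse f \<in> {f. val_ge v f 0}" for f
    by (auto simp: val_ge_def val_inverse)
qed

lemma vunit_of_place: "f \<in> valuation_ring.vunit {f. val_ge v f 0} \<longleftrightarrow> f \<noteq> 0 \<and> v f = 0"
  unfolding valuation_ring.vunit_def[OF valuation_ring_of_place]
  by (auto simp: val_ge_def val_inverse)

lemma vmax_of_place: "f \<in> valuation_ring.vmax {f. val_ge v f 0} \<longleftrightarrow> val_ge v f 1"
  unfolding valuation_ring.vmax_iff[OF valuation_ring_of_place]
  by (auto simp: val_ge_def val_inverse)

end

section \<open>Algebraic preliminaries\<close>

lemma char2_uminus: "(2::'a::comm_ring_1) = 0 \<Longrightarrow> - (a::'a) = a"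
  by (metis add_eq_0_iff2 mult_2 mult_zero_left)

lemma char2_diff: "(2::'a::comm_ring_1) = 0 \<Longrightarrow> (a::'a) - b = a + b"
  using char2_uminus[of b] by (metis diff_conv_add_uminus)

lemma char2_power_add:
  "(2::'a::comm_ring_1) = 0 \<Longrightarrow> ((a::'a) + b) ^ (2 ^ n) = a ^ (2 ^ n) + b ^ (2 ^ n)"
proof (induction n)
  case (Suc n)
  have "(a + b) ^ 2 ^ Suc n = ((a + b) ^ 2 ^ n)\<^sup>2" by (simp add: power_mult[symmetric] mult.commute)
  also have "\<dots> = (a ^ 2 ^ n)\<^sup>2 + (b ^ 2 ^ n)\<^sup>2 + 2 * a ^ 2 ^ n * b ^ 2 ^ n"
    using Suc by (simp add: power2_sum)
  finally show ?case using Suc.prems by (simp add: power_mult[symmetric] mult.commute)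
qed simp

lemma char2_power_diff:
  "(2::'a::comm_ring_1) = 0 \<Longrightarrow> ((a::'a) - b) ^ (2 ^ n) = a ^ (2 ^ n) - b ^ (2 ^ n)"
  by (simp add: char2_diff char2_power_add)

section \<open>Finite fields, linear systems and polynomials\<close>

lemma card_eq_zero_in_finite_field: "of_nat CARD('f) = (0::'f::{finite,field})"
proof -
  have "(\<Sum>a\<in>UNIV. a + 1 :: 'f) = (\<Sum>a\<in>UNIV. a)"
    by (rule sum.reindex_bij_witness[of _ "\<lambda>a. a - 1" "\<lambda>a. a + 1"]) auto
  then show ?thesis by (simp add: sum.distrib)
qed

text \<open>Multiplication by a nonzero \<open>c\<close> permutes the nonzero elements, so the
  product of all of them can be cancelled.\<close>

lemma power_card_finite_field: "(c::'f::{finite,field}) ^ CARD('f) = c"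
proof (cases "c = 0")
  case False
  have "(\<Prod>a\<in>UNIV-{0}. c * a) = (\<Prod>a\<in>UNIV-{0}. a)"
    by (rule prod.reindex_bij_witness[of _ "\<lambda>a. a / c" "\<lambda>a. c * a"]) (use False in auto)
  then have "c ^ (CARD('f) - 1) = 1" by (simp add: prod.distrib)
  moreover have "CARD('f) = Suc (CARD('f) - 1)" using zero_less_card_finite[where 'a = 'f] by simp
  ultimately show ?thesis by (metis mult.right_neutral power_Suc)
qed simp

text \<open>Both sides have degree at most \<open>CARD('f)\<close>, the same coefficient there, and
  vanish at all elements of the field.\<close>

lemma prod_linear_finite_field:
  "(\<Prod>a\<in>(UNIV::'f::{finite,field} set). [:- a, 1:]) = monom 1 CARD('f) - [:0, 1:]" (is "?P = ?Q")
proof (rule poly_eqI_degree_lead_coeff[where A = UNIV and n = "CARD('f)"])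
  have "CARD('f) \<noteq> 1"
  proof
    assume "CARD('f) = 1"
    then obtain a where "UNIV = {a::'f}" by (auto simp: card_1_singleton_iff)
    then show False by (metis UNIV_I singletonD zero_neq_one)
  qed
  then have card: "CARD('f) > 1" using zero_less_card_finite[where 'a = 'f] by linarith
  have deg: "degree ?P = CARD('f)" by (subst degree_prod_eq_sum_degree) auto
  have "lead_coeff ?P = 1" by (simp add: lead_coeff_prod)
  then show "coeff ?P CARD('f) = coeff ?Q CARD('f)"
    using card deg by (simp add: coeff_pCons split: nat.splits)
  show "degree ?P \<le> CARD('f)" using deg by simp
  show "degree ?Q \<le> CARD('f)"
    using card by (intro degree_diff_le) (auto simp: degree_monom_eq)
  show "poly ?P a = poly ?Q a" for a
  proof -
    have "poly ?P a = 0" by (simp add: poly_prod)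
    then show ?thesis by (simp add: poly_monom power_card_finite_field)
  qed
qed simp

lemma finite_degree_less: "finite {p :: 'f::{finite,zero} poly. degree p < n}"
proof (rule finite_subset)
  show "{p :: 'f poly. degree p < n} \<subseteq> Poly ` {xs. set xs \<subseteq> UNIV \<and> length xs \<le> n}"
  proof
    fix p :: "'f poly" assume "p \<in> {p. degree p < n}"
    then have "length (coeffs p) \<le> n" by (auto simp: length_coeffs_degree Suc_le_eq coeffs_def)
    then show "p \<in> Poly ` {xs. set xs \<subseteq> UNIV \<and> length xs \<le> n}" by (intro image_eqI[of _ _ "coeffs p"]) auto
  qed
  show "finite (Poly ` {xs. set xs \<subseteq> (UNIV::'f set) \<and> length xs \<le> n})"
    using finite_lists_length_le[of "UNIV :: 'f set" n] by simp
qed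

text \<open>Gaussian elimination without division, so that it applies to polynomial entries: a
  homogeneous system with more unknowns than equations has a nontrivial solution.\<close>

lemma exists_linear_dependence:
  fixes M :: "'j \<Rightarrow> 'i \<Rightarrow> 'a::idom"
  assumes "finite I" "finite J" "card I < card J"
  shows "\<exists>c. (\<exists>j\<in>J. c j \<noteq> 0) \<and> (\<forall>i\<in>I. (\<Sum>j\<in>J. c j * M j i) = 0)"
  using assms
proof (induction I arbitrary: J M rule: finite_induct)
  case empty
  then have "J \<noteq> {}" by auto
  then show ?case by (intro exI[of _ "\<lambda>_. 1"]) auto
next
  case (insert i0 I)
  show ?case
  proof (cases "\<forall>j\<in>J. M j i0 = 0")
    case True
    have "card I < card J" using insert by simp
    then obtain c where "\<exists>j\<in>J. c j \<noteq> 0" "\<forall>i\<in>I. (\<Sum>j\<in>J. c j * M j i) = 0"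
      using insert.IH[of J M] insert.prems by blast
    then show ?thesis using True by (intro exI[of _ c]) auto
  next
    case False
    then obtain j0 where j0: "j0 \<in> J" "M j0 i0 \<noteq> 0" by blast
    define N where "N j i = M j0 i0 * M j i - M j i0 * M j0 i" for j i
    have "card I < card (J - {j0})" using insert j0 by auto
    then obtain c where c: "\<exists>j\<in>J - {j0}. c j \<noteq> 0"
        "\<And>i. i \<in> I \<Longrightarrow> (\<Sum>j\<in>J - {j0}. c j * N j i) = 0"
      using insert.IH[of "J - {j0}" N] insert.prems by blast
    \<comment> \<open>The other coefficients are scaled by the pivot \<open>M j0 i0\<close> to avoid
      dividing by it, and the one at \<open>j0\<close> is chosen so that equation \<open>i0\<close>
      holds.\<close>
    define d where "d j = (if j = j0 then - (\<Sum>j\<in>J - {j0}. c j * M j i0) else M j0 i0 * c j)" for j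
    have d: "(\<Sum>j\<in>J. d j * M j i) = (\<Sum>j\<in>J - {j0}. c j * N j i)" for i
    proof -
      have "(\<Sum>j\<in>J. d j * M j i) = d j0 * M j0 i + (\<Sum>j\<in>J - {j0}. d j * M j i)"
        using j0 insert.prems by (simp add: sum.remove)
      also have "(\<Sum>j\<in>J - {j0}. d j * M j i) = (\<Sum>j\<in>J - {j0}. M j0 i0 * c j * M j i)"
        by (intro sum.cong) (auto simp: d_def)
      also have "d j0 * M j0 i = - (\<Sum>j\<in>J - {j0}. c j * M j i0 * M j0 i)"
        by (simp add: d_def sum_distrib_right)
      finally show ?thesis by (simp add: N_def sum_subtractf algebra_simps)
    qed
    have "(\<Sum>j\<in>J. d j * M j i0) = 0" unfolding d N_def by (simp add: mult.commute)
    moreover obtain j where "j \<in> J - {j0}" "c j \<noteq> 0" using c(1) by blast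
    then have "j \<in> J" "d j \<noteq> 0" using j0(2) by (auto simp: d_def)
    then have "\<exists>j\<in>J. d j \<noteq> 0" by blast
    ultimately show ?thesis using c(2) d by (intro exI[of _ d]) auto
  qed
qed

text \<open>A divisor of least positive degree cannot be split further.\<close>

lemma exists_irreducible_factor:
  fixes B :: "'a::field poly"
  assumes "degree B > 0"
  obtains p where "p dvd B" "irreducible p" "degree p > 0"
proof -
  define p where "p = (ARG_MIN degree p. p dvd B \<and> degree p > 0)"
  have p: "p dvd B \<and> degree p > 0" and min: "\<And>r. r dvd B \<Longrightarrow> degree r > 0 \<Longrightarrow> degree p \<le> degree r"
    using arg_min_nat_lemma[of "\<lambda>p. p dvd B \<and> degree p > 0" B degree] assms
    unfolding p_def by auto
  have "irreducible p"
  proof (rule irreducibleI)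
    show p0: "p \<noteq> 0" using p by auto
    show "\<not> p dvd 1" using p is_unit_iff_degree[OF p0] by simp
    fix a b assume ab: "p = a * b"
    then have "a \<noteq> 0" "b \<noteq> 0" using p by auto
    then have deg: "degree p = degree a + degree b" using ab by (simp add: degree_mult_eq)
    have "degree a = 0 \<or> degree b = 0"
    proof (rule ccontr)
      assume "\<not> ?thesis"
      moreover have "a dvd B" "b dvd B" using p unfolding ab by (auto dest: dvd_mult_left dvd_mult_right)
      ultimately show False using min[of a] min[of b] deg by simp
    qed
    then show "a dvd 1 \<or> b dvd 1" using \<open>a \<noteq> 0\<close> \<open>b \<noteq> 0\<close> by (auto simp: is_unit_iff_degree)
  qed
  then show ?thesis using that p by blast
qed

lemma prime_power_decompose:
  fixes p c :: "'a::field poly"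
  assumes "degree p > 0" "c \<noteq> 0"
  shows "\<exists>j c'. c = p ^ j * c' \<and> \<not> p dvd c'"
  using assms(2)
proof (induction "degree c" arbitrary: c rule: less_induct)
  case less
  show ?case
  proof (cases "p dvd c")
    case True
    then obtain k where k: "c = p * k" by blast
    then have "k \<noteq> 0" "p \<noteq> 0" using less.prems by auto
    then have "degree k < degree c" using assms k by (simp add: degree_mult_eq)
    from less.hyps[OF this \<open>k \<noteq> 0\<close>] obtain j c' where "k = p ^ j * c'" "\<not> p dvd c'" by blast
    then show ?thesis using k by (intro exI[of _ "Suc j"] exI[of _ c']) auto
  qed (auto intro: exI[of _ 0])
qed

section \<open>Evaluation of polynomials, and residues of functions\<close>

locale eval_at =
  fixes \<iota> :: "'f::field \<Rightarrow> 'K::field" and x :: 'K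
  assumes hom: "is_field_hom \<iota>"
begin

definition ev :: "'f poly \<Rightarrow> 'K" where "ev p = poly (map_poly \<iota> p) x"

lemma ev_0 [simp]: "ev 0 = 0"
  by (simp add: ev_def)

lemma ev_pCons [simp]: "ev (pCons a p) = \<iota> a + x * ev p"
  by (simp add: ev_def map_poly_pCons is_field_homD[OF hom])

lemma ev_1 [simp]: "ev 1 = 1"
  using ev_pCons[of 1 0] by (simp add: one_pCons is_field_homD[OF hom])

lemma ev_add: "ev (p + r) = ev p + ev r"
proof (induction p arbitrary: r)
  case (pCons a p)
  then show ?case by (cases r) (auto simp: is_field_homD[OF hom] algebra_simps)
qed simp

lemma ev_smult: "ev (smult c p) = \<iota> c * ev p"
  by (induction p) (auto simp: is_field_homD[OF hom] algebra_simps)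

lemma ev_minus: "ev (- p) = - ev p"
  using ev_smult[of "-1" p] by (simp add: is_field_homD[OF hom])

lemma ev_diff: "ev (p - r) = ev p - ev r"
  using ev_add[of p "- r"] ev_minus by simp

lemma ev_mult: "ev (p * r) = ev p * ev r"
  by (induction p) (auto simp: ev_add ev_smult is_field_homD[OF hom] algebra_simps)

lemma ev_power: "ev (p ^ n) = ev p ^ n"
  by (induction n) (auto simp: ev_mult)

lemma ev_sum: "ev (sum f I) = (\<Sum>i\<in>I. ev (f i))"
  by (induction I rule: infinite_finite_induct) (auto simp: ev_add)

lemma ev_prod: "ev (prod f I) = (\<Prod>i\<in>I. ev (f i))"
  by (induction I rule: infinite_finite_induct) (auto simp: ev_mult)

lemma ev_monom: "ev (monom c n) = \<iota> c * x ^ n"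
  by (induction n) (auto simp: monom_0 monom_Suc is_field_homD[OF hom])

end

lemma prod_linear_eq:
  fixes \<iota> :: "'f::{finite,field} \<Rightarrow> 'K::field"
  assumes "is_field_hom \<iota>"
  shows "(\<Prod>a\<in>UNIV. f - \<iota> a) = f ^ CARD('f) - f"
proof -
  interpret eval_at \<iota> f by standard (rule assms)
  have "ev (\<Prod>a\<in>UNIV. [:- a, 1:]) = ev (monom 1 CARD('f) - [:0, 1:])"
    by (simp only: prod_linear_finite_field)
  then show ?thesis
    by (simp add: ev_prod ev_diff ev_monom is_field_homD[OF assms])
qed

context place
begin

text \<open>If no factor \<open>f - \<iota> c\<close> had positive valuation, neither would their
  product. Finiteness and the product formula are hypotheses because the locale \<open>place\<close>
  fixes \<open>'f\<close> only as a field.\<close>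

lemma exists_residue:
  fixes f :: 'K
  assumes fin: "finite (UNIV :: 'f set)" and f: "val_ge v (f ^ CARD('f) - f) 1"
    and prod: "(\<Prod>a\<in>UNIV. f - \<iota> a) = f ^ CARD('f) - f"
  shows "\<exists>c. val_ge v (f - \<iota> c) 1"
proof (rule ccontr)
  assume neg: "\<not> ?thesis"
  then have nge: "\<not> val_ge v (f - \<iota> c) 1" for c by blast
  have nz: "f - \<iota> c \<noteq> 0" for c using nge[of c] unfolding val_ge_def by blast
  have le: "v (f - \<iota> c) \<le> 0" for c using nge[of c] unfolding val_ge_def by linarith
  have "v (\<Prod>a\<in>UNIV. f - \<iota> a) = (\<Sum>a\<in>UNIV. v (f - \<iota> a))"
    using fin nz by (intro val_prod) auto
  also have "\<dots> \<le> 0" using le by (intro sum_nonpos) auto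
  finally show False using f nz fin unfolding prod[symmetric] by (auto simp: val_ge_def)
qed

end


section \<open>The Suzuki function field\<close>

locale suzuki = eval_at \<iota> x for \<iota> :: "'f::{finite,field} \<Rightarrow> 'K::field" and x :: 'K +
  fixes m :: nat and y z w :: 'K
  assumes m: "m \<ge> 1"
    and card: "CARD('f) = suz_q m"
    and transcendental: "transcendental_over \<iota> x"
    and curve: "y ^ suz_q m + y = x ^ suz_q0 m * (x ^ suz_q m + x)"
    and generated: "generated_by \<iota> x y"
    and z_def: "z = x ^ (2 * suz_q0 m + 1) - y ^ (2 * suz_q0 m)"
    and w_def: "w = x * y ^ (2 * suz_q0 m) - z ^ (2 * suz_q0 m)"
begin

abbreviation q :: nat where "q \<equiv> suz_q m"
abbreviation q0 :: nat where "q0 \<equiv> suz_q0 m"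

definition X :: 'K where "X = x ^ q + x"

lemma q_eq: "q = 2 * q0 * q0"
  unfolding suz_q_def suz_q0_def by (simp only: mult_2 power_add power_one_right) (simp add: algebra_simps)

lemma q0_ge_2: "2 \<le> q0"
  using m power_increasing[of 1 m "2::nat"] by (simp add: suz_q0_def)

lemma q_ge_8: "8 \<le> q"
proof -
  have "2 * 2 \<le> q0 * q0" using q0_ge_2 by (intro mult_mono) auto
  then show ?thesis using q_eq by simp
qed

lemmas hom_simps = is_field_homD[OF hom]

lemma char2: "(2::'K) = 0"
proof -
  have "(2::'f) ^ (2 * m + 1) = of_nat CARD('f)" by (simp add: card suz_q_def)
  then have "(2::'f) ^ (2 * m + 1) = 0" using card_eq_zero_in_finite_field[where 'f = 'f] by simp
  then have "(2::'f) = 0" by (metis power_not_zero)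
  then have "(1::'f) + 1 = 0" by simp
  then have "\<iota> 1 + \<iota> 1 = 0" using hom_simps(1,3) by metis
  then show ?thesis by (simp add: hom_simps)
qed

lemmas char2_simps = char2_diff[OF char2] char2_uminus[OF char2]

lemma add_self: "(a::'K) + a = 0"
  using char2 by (metis mult_2 mult_zero_left)

lemma add_self_left: "(a::'K) + (a + b) = b"
  using add_self[of a] by (simp flip: add.assoc)

lemmas char2_algebra = algebra_simps power2_eq_square add_self add_self_left

section \<open>Frobenius powers of the coordinate functions\<close>

lemma frob_q0: "((a::'K) + b) ^ q0 = a ^ q0 + b ^ q0"
  unfolding suz_q0_def by (rule char2_power_add[OF char2])

lemma frob_2q0: "((a::'K) + b) ^ (2 * q0) = a ^ (2 * q0) + b ^ (2 * q0)"
  using char2_power_add[OF char2, of a b "Suc m"] by (simp add: suz_q0_def)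

lemma frob_q: "((a::'K) + b) ^ q = a ^ q + b ^ q"
  unfolding suz_q_def by (rule char2_power_add[OF char2])

lemma const_power_q: "\<iota> c ^ q = \<iota> c"
  using power_card_finite_field[of c] by (simp add: card flip: hom_simps)

text \<open>Since q = q0 * (2 * q0), the q-Frobenius factors in two orders. Applying the power
  \<open>q0\<close> to the definitions of \<open>z\<close> and \<open>w\<close> and then the power
  \<open>2 * q0\<close> to the results produces the identities below.\<close>

lemma power_q_eq: "(a::'K) ^ q = (a ^ q0) ^ (2 * q0)" "(a::'K) ^ q = (a ^ (2 * q0)) ^ q0"
  by (simp_all add: q_eq power_mult[symmetric] mult_ac)

lemma x_power_q: "x ^ q = X + x"
  using add_self[of x] by (simp add: X_def add.assoc)

lemma y_power_q: "y ^ q = y + x ^ q0 * X"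
  using curve add_self[of y] unfolding X_def[symmetric] by (metis add.assoc add.commute add_0)

lemma z_eq: "z = x ^ (2 * q0) * x + y ^ (2 * q0)"
  by (simp add: z_def char2_simps mult.commute)

lemma w_eq: "w = x * y ^ (2 * q0) + z ^ (2 * q0)"
  by (simp add: w_def char2_simps)

lemma z_power_q0: "z ^ q0 = y + x ^ q0 * x"
proof -
  have "z ^ q0 = (x ^ (2 * q0)) ^ q0 * x ^ q0 + (y ^ (2 * q0)) ^ q0"
    by (simp only: z_eq frob_q0 power_mult_distrib)
  also have "\<dots> = x ^ q * x ^ q0 + y ^ q" by (simp only: power_q_eq(2))
  finally show ?thesis unfolding y_power_q x_power_q by (simp add: char2_algebra)
qed

text \<open>The term \<open>z ^ (2 * q0)\<close> in \<open>w\<close> is the square of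
  \<open>z_power_q0\<close>. The resulting quadratic relation serves to eliminate
  \<open>y\<^sup>2\<close>.\<close>

lemma w_eq': "w = y\<^sup>2 + x * z"
proof -
  have "z ^ (2 * q0) = (z ^ q0)\<^sup>2" "x ^ (2 * q0) = (x ^ q0)\<^sup>2" by (simp_all add: power_mult[symmetric] mult.commute)
  then have "w = x * y ^ (2 * q0) + (y + x ^ q0 * x)\<^sup>2" "z = (x ^ q0)\<^sup>2 * x + y ^ (2 * q0)"
    using w_eq z_eq z_power_q0 by simp_all
  then show ?thesis by (simp add: char2_algebra)
qed

text \<open>In characteristic 2 this is an Artin-Schreier equation for \<open>z\<close>, like the
  curve equation for \<open>y\<close> and \<open>w_power_q\<close> for \<open>w\<close>. Pole orders
  are read off from these three equations.\<close>

lemma z_power_q: "z ^ q = z + x ^ (2 * q0) * X"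
proof -
  have "z ^ q = y ^ (2 * q0) + x ^ q * x ^ (2 * q0)"
    unfolding power_q_eq(1)[of z] z_power_q0 by (simp only: frob_2q0 power_mult_distrib power_q_eq(1))
  then show ?thesis unfolding x_power_q by (simp add: z_eq char2_algebra)
qed

lemma w_power_q0: "w ^ q0 = x ^ q0 * y + z"
proof -
  have "w ^ q0 = x ^ q0 * y ^ q + z ^ q"
    by (simp only: w_eq frob_q0 power_mult_distrib power_q_eq(2))
  moreover have "x ^ (2 * q0) = (x ^ q0)\<^sup>2" by (simp add: power_mult[symmetric] mult.commute)
  ultimately show ?thesis unfolding y_power_q z_power_q by (simp add: char2_algebra)
qed

lemma w_power_q: "w ^ q = w + y ^ (2 * q0) * X"
proof -
  have "w ^ q = x ^ q * y ^ (2 * q0) + z ^ (2 * q0)"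
    unfolding power_q_eq(1)[of w] w_power_q0 by (simp only: frob_2q0 power_mult_distrib power_q_eq(1))
  then show ?thesis unfolding x_power_q by (simp add: w_eq char2_algebra)
qed

lemma ev_eq_0_iff: "ev p = 0 \<longleftrightarrow> p = 0"
  using transcendental unfolding transcendental_over_def ev_def by auto

lemma x_nonzero: "x \<noteq> 0"
  using ev_eq_0_iff[of "[:0, 1:]"] by (simp add: hom_simps)

lemma X_as_ev: "X = ev (monom 1 q + monom 1 1)"
  by (simp add: X_def ev_add ev_monom hom_simps)

lemma X_nonzero: "X \<noteq> 0"
proof -
  have "coeff (monom 1 q + monom 1 1 :: 'f poly) 1 \<noteq> 0" using q_ge_8 by simp
  then have "monom 1 q + monom 1 1 \<noteq> (0 :: 'f poly)" by (metis coeff_0)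
  then show ?thesis unfolding X_as_ev ev_eq_0_iff .
qed

sublocale vs: vector_space "\<lambda>c f. \<iota> c * f"
  by standard (auto simp: hom_simps algebra_simps)

subsection \<open>The affine coordinate ring\<close>

inductive_set R :: "'K set" where
  const: "\<iota> c \<in> R"
| x: "x \<in> R"
| y: "y \<in> R"
| add: "a \<in> R \<Longrightarrow> b \<in> R \<Longrightarrow> a + b \<in> R"
| mult: "a \<in> R \<Longrightarrow> b \<in> R \<Longrightarrow> a * b \<in> R"

lemma R_1: "1 \<in> R" and R_0: "0 \<in> R"
  using R.const[of 1] R.const[of 0] by (simp_all add: hom_simps)

lemma R_diff: "a \<in> R \<Longrightarrow> b \<in> R \<Longrightarrow> a - b \<in> R"
  by (simp add: char2_simps R.add)

lemma R_power: "a \<in> R \<Longrightarrow> a ^ n \<in> R"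
  by (induction n) (auto intro: R_1 R.mult)

lemma R_sum: "(\<And>i. i \<in> I \<Longrightarrow> f i \<in> R) \<Longrightarrow> sum f I \<in> R"
  by (induction I rule: infinite_finite_induct) (auto intro: R_0 R.add)

lemma z_in_R: "z \<in> R" and w_in_R: "w \<in> R" and X_in_R: "X \<in> R"
proof -
  show z: "z \<in> R" unfolding z_eq by (intro R.intros R_power)
  show "w \<in> R" unfolding w_eq' by (intro R.intros R_power z)
  show "X \<in> R" unfolding X_def by (intro R.intros R_power)
qed

lemma ev_in_R: "ev p \<in> R"
  by (induction p) (auto intro: R.intros R_0)

definition smon :: "nat \<Rightarrow> nat \<Rightarrow> nat \<Rightarrow> nat \<Rightarrow> nat \<Rightarrow> 'K" where
  "smon a b c d s = x ^ a * y ^ b * z ^ c * w ^ d * X ^ s"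

text \<open>The allowed exponents \<open>B\<close> of \<open>y\<close> are a parameter because
  products with \<open>y\<close>, \<open>z\<close> and \<open>w\<close> are reduced first for
  exponent 0, where no square of \<open>y\<close> can arise.\<close>

definition smons :: "nat set \<Rightarrow> 'K set" where
  "smons B = {smon a b c d s | a b c d s. a < q \<and> b \<in> B \<and> c < q0 \<and> d < q0}"

lemma smonsI: "a < q \<Longrightarrow> b \<in> B \<Longrightarrow> c < q0 \<Longrightarrow> d < q0 \<Longrightarrow> smon a b c d s \<in> smons B"
  unfolding smons_def by blast

lemma smonsE:
  assumes "f \<in> smons B"
  obtains a b c d s where "f = smon a b c d s" "a < q" "b \<in> B" "c < q0" "d < q0"
  using assms unfolding smons_def by blast

lemma smon_in_R: "smon a b c d s \<in> R"
  unfolding smon_def by (intro R.intros R_power z_in_R w_in_R X_in_R)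

section \<open>Rewriting products in terms of the monomials\<close>

lemma times_span:
  assumes "\<And>s. s \<in> S \<Longrightarrow> u * s \<in> vs.span S'" and "f \<in> vs.span S"
  shows "u * f \<in> vs.span S'"
  using assms(2)
proof (induction rule: vs.span_induct)
  show "vs.subspace {f. u * f \<in> vs.span S'}"
    unfolding vs.subspace_def
    using vs.span_zero vs.span_add vs.span_scale[of _ S']
    by (auto simp: distrib_left mult.left_commute[of u])
qed (use assms(1) in auto)

text \<open>When the exponent of \<open>x\<close> reaches \<open>q\<close>, the relation
  \<open>x ^ q = X + x\<close> splits the product into two admissible monomials.\<close>

lemma x_times_smons: "f \<in> vs.span (smons B) \<Longrightarrow> x * f \<in> vs.span (smons B)"
proof (erule times_span[rotated])
  fix f assume "f \<in> smons B"
  then obtain a b c d s where f: "f = smon a b c d s" "a < q" "b \<in> B" "c < q0" "d < q0" by (rule smonsE)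
  show "x * f \<in> vs.span (smons B)"
  proof (cases "Suc a < q")
    case True
    have "x * f = smon (Suc a) b c d s" by (simp add: f smon_def)
    then show ?thesis using f True by (simp add: vs.span_base smonsI)
  next
    case False
    then have "Suc a = q" using f by simp
    then have *: "x * x ^ a = X + x" using x_power_q by (metis power_Suc)
    have "x * f = (x * x ^ a) * smon 0 b c d s" by (simp add: f smon_def mult_ac)
    then have "x * f = smon 0 b c d (Suc s) + smon 1 b c d s"
      unfolding * by (simp add: smon_def algebra_simps)
    then show ?thesis using f q_ge_8 by (simp add: vs.span_base vs.span_add smonsI)
  qed
qed

lemma x_power_times_smons: "f \<in> vs.span (smons B) \<Longrightarrow> x ^ n * f \<in> vs.span (smons B)"
  by (induction n) (auto simp: x_times_smons mult.assoc)

lemma y_times_smons_0: "f \<in> smons {0} \<Longrightarrow> y * f \<in> vs.span (smons {0,1})"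
proof -
  assume "f \<in> smons {0}"
  then obtain a c d s where f: "f = smon a 0 c d s" "a < q" "c < q0" "d < q0" by (auto elim: smonsE)
  have "y * f = smon a 1 c d s" by (simp add: f smon_def)
  then show ?thesis using f by (simp add: vs.span_base smonsI)
qed

lemma smons_0_subset: "smons {0} \<subseteq> vs.span (smons {0,1})"
  using vs.span_superset[of "smons {0,1}"] unfolding smons_def by blast

text \<open>When the exponent of \<open>z\<close> reaches \<open>q0\<close>, the power is replaced
  by \<open>y + x ^ q0 * x\<close>, which raises the exponent of \<open>y\<close> to at most
  1.\<close>

lemma z_times_smons_0: "f \<in> smons {0} \<Longrightarrow> z * f \<in> vs.span (smons {0,1})"
proof -
  assume "f \<in> smons {0}"
  then obtain a c d s where f: "f = smon a 0 c d s" "a < q" "c < q0" "d < q0" by (auto elim: smonsE)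
  show ?thesis
  proof (cases "Suc c < q0")
    case True
    have "z * f = smon a 0 (Suc c) d s" by (simp add: f smon_def)
    then show ?thesis using f True by (simp add: vs.span_base smonsI)
  next
    case False
    then have "Suc c = q0" using f by simp
    then have *: "z * z ^ c = y + x ^ q0 * x" using z_power_q0 by (metis power_Suc)
    define g where "g = smon a 0 0 d s"
    have g: "g \<in> smons {0}" using f q0_ge_2 unfolding g_def by (intro smonsI) auto
    have "z * f = (z * z ^ c) * g" by (simp add: f g_def smon_def mult_ac)
    then have "z * f = y * g + x ^ q0 * (x * g)" unfolding * by (simp add: algebra_simps)
    then show ?thesis using g y_times_smons_0 smons_0_subset
      by (auto intro!: vs.span_add x_power_times_smons x_times_smons)
  qed
qed

text \<open>When the exponent of \<open>w\<close> reaches \<open>q0\<close>, the power becomes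
  \<open>x ^ q0 * y + z\<close>; the second term is covered by
  \<open>z_times_smons_0\<close>.\<close>

lemma w_times_smons_0: "f \<in> smons {0} \<Longrightarrow> w * f \<in> vs.span (smons {0,1})"
proof -
  assume "f \<in> smons {0}"
  then obtain a c d s where f: "f = smon a 0 c d s" "a < q" "c < q0" "d < q0" by (auto elim: smonsE)
  show ?thesis
  proof (cases "Suc d < q0")
    case True
    have "w * f = smon a 0 c (Suc d) s" by (simp add: f smon_def)
    then show ?thesis using f True by (simp add: vs.span_base smonsI)
  next
    case False
    then have "Suc d = q0" using f by simp
    then have *: "w * w ^ d = x ^ q0 * y + z" using w_power_q0 by (metis power_Suc)
    define g where "g = smon a 0 c 0 s"
    have g: "g \<in> smons {0}" using f q0_ge_2 unfolding g_def by (intro smonsI) auto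
    have "w * f = (w * w ^ d) * g" by (simp add: f g_def smon_def mult_ac)
    then have "w * f = x ^ q0 * (y * g) + z * g" unfolding * by (simp add: algebra_simps)
    then show ?thesis using y_times_smons_0[OF g] z_times_smons_0[OF g]
      by (auto intro!: vs.span_add x_power_times_smons)
  qed
qed

text \<open>A square of \<open>y\<close> turns into \<open>w + x * z\<close>. What remains is free
  of \<open>y\<close>, so the previous reductions apply and the rewriting is not circular.\<close>

lemma y_times_smons: "f \<in> vs.span (smons {0,1}) \<Longrightarrow> y * f \<in> vs.span (smons {0,1})"
proof (erule times_span[rotated])
  fix f assume "f \<in> smons {0,1}"
  then obtain a b c d s where f: "f = smon a b c d s" "a < q" "b \<in> {0,1}" "c < q0" "d < q0" by (rule smonsE)
  define g where "g = smon a 0 c d s"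
  have g: "g \<in> smons {0}" using f unfolding g_def by (intro smonsI) auto
  show "y * f \<in> vs.span (smons {0,1})"
  proof (cases "b = 0")
    case True
    then show ?thesis using y_times_smons_0[OF g] by (simp add: f g_def)
  next
    case False
    then have "y * f = y\<^sup>2 * g" using f by (simp add: g_def smon_def power2_eq_square mult_ac)
    also have "y\<^sup>2 = w + x * z" unfolding w_eq' by (simp add: char2_algebra)
    finally have "y * f = w * g + x * (z * g)" by (simp add: algebra_simps)
    then show ?thesis using w_times_smons_0[OF g] z_times_smons_0[OF g]
      by (auto intro!: vs.span_add x_times_smons)
  qed
qed

text \<open>The span contains 1 and is stable under multiplication by the generators of
  \<open>R\<close>.\<close>

lemma R_eq_span: "R = vs.span (smons {0,1})"
proof
  have one: "1 \<in> vs.span (smons {0,1})"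
  proof (rule vs.span_base)
    have "smon 0 0 0 0 0 \<in> smons {0,1}" using q_ge_8 q0_ge_2 by (intro smonsI) auto
    then show "1 \<in> smons {0,1}" by (simp add: smon_def)
  qed
  have "\<forall>f\<in>vs.span (smons {0,1}). r * f \<in> vs.span (smons {0,1})" if "r \<in> R" for r
    using that
    by (induction rule: R.induct)
      (auto intro: x_times_smons y_times_smons[simplified] vs.span_scale vs.span_add
        simp: distrib_right mult.assoc)
  then show "R \<subseteq> vs.span (smons {0,1})" using one by force
  have "vs.subspace R"
    unfolding vs.subspace_def using R_0 R.add R.mult[OF R.const] by auto
  moreover have "smons {0,1} \<subseteq> R" using smon_in_R by (auto simp: smons_def)
  ultimately show "vs.span (smons {0,1}) \<subseteq> R" by (intro vs.span_minimal)
qed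

section \<open>Functions as fractions of \<open>R\<close> over polynomials in
  \<open>x\<close>\<close>

definition exps :: "(nat \<times> nat \<times> nat) set" where "exps = {0,1} \<times> {..<q0} \<times> {..<q0}"

definition bas :: "nat \<times> nat \<times> nat \<Rightarrow> 'K" where "bas = (\<lambda>(b, c, d). y ^ b * z ^ c * w ^ d)"

text \<open>\<open>X\<close> is a polynomial in \<open>x\<close>, so the factors
  \<open>x ^ a * X ^ s\<close> become coefficients and \<open>R\<close> is a finitely generated
  module over the polynomials in \<open>x\<close>.\<close>

lemma R_module_rep:
  assumes "r \<in> R"
  shows "\<exists>p. r = (\<Sum>i\<in>exps. ev (p i) * bas i)"
proof -
  have fin: "finite exps" by (simp add: exps_def)
  let ?S = "{r. \<exists>p. r = (\<Sum>i\<in>exps. ev (p i) * bas i)}"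
  have "vs.span (smons {0,1}) \<subseteq> ?S"
  proof (rule vs.span_minimal)
    show "smons {0,1} \<subseteq> ?S"
    proof
      fix f assume "f \<in> smons {0,1}"
      then obtain a b c d s where f: "f = smon a b c d s" "b \<in> {0,1}" "c < q0" "d < q0" by (rule smonsE)
      define P where "P = monom (1::'f) a * (monom 1 q + monom 1 1) ^ s"
      have "ev P = x ^ a * X ^ s"
        by (simp add: P_def ev_mult ev_power X_as_ev ev_monom hom_simps)
      then have "f = ev P * bas (b, c, d)" by (simp add: f smon_def bas_def)
      also have "\<dots> = (\<Sum>i\<in>exps. if i = (b, c, d) then ev P * bas i else 0)"
        using fin f by (simp add: exps_def)
      also have "\<dots> = (\<Sum>i\<in>exps. ev (if i = (b, c, d) then P else 0) * bas i)"
        by (intro sum.cong) auto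
      finally show "f \<in> ?S" by (intro CollectI exI)
    qed
    show "vs.subspace ?S"
      unfolding vs.subspace_def
    proof (intro conjI ballI allI)
      show "0 \<in> ?S" by (intro CollectI exI[of _ "\<lambda>_. 0"]) simp
      fix f g c assume "f \<in> ?S"
      then obtain p where p: "f = (\<Sum>i\<in>exps. ev (p i) * bas i)" by blast
      show "\<iota> c * f \<in> ?S"
        by (intro CollectI exI[of _ "\<lambda>i. smult c (p i)"])
          (simp add: p ev_smult sum_distrib_left mult.assoc)
      assume "g \<in> ?S"
      then obtain p' where p': "g = (\<Sum>i\<in>exps. ev (p' i) * bas i)" by blast
      show "f + g \<in> ?S"
        by (intro CollectI exI[of _ "\<lambda>i. p i + p' i"])
          (simp add: p p' ev_add sum.distrib distrib_right)
    qed
  qed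
  then show ?thesis using assms R_eq_span by blast
qed

text \<open>There is one more power of \<open>r\<close> among exponents 0 to
  \<open>card exps\<close> than there are module generators, so these powers satisfy a polynomial
  relation. After cancelling the lowest power of \<open>r\<close>, every other term is divisible by
  \<open>r\<close>, which exhibits the lowest coefficient as a multiple of \<open>r\<close>.\<close>

lemma R_divides_ev:
  assumes r: "r \<in> R" "r \<noteq> 0"
  obtains r' c where "r' \<in> R" "c \<noteq> 0" "r * r' = ev c"
proof -
  obtain P where P: "\<And>k. r ^ k = (\<Sum>i\<in>exps. ev (P k i) * bas i)"
    using R_module_rep[OF R_power[OF r(1)]] by metis
  have fin: "finite exps" by (simp add: exps_def)
  define J where "J = {..card exps}"
  have J: "finite J" "card exps < card J" by (simp_all add: J_def)
  from exists_linear_dependence[OF fin J, of P] obtain c where c: "\<exists>j\<in>J. c j \<noteq> 0"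
      "\<And>i. i \<in> exps \<Longrightarrow> (\<Sum>j\<in>J. c j * P j i) = 0" by blast
  have "(\<Sum>j\<in>J. ev (c j) * r ^ j) = (\<Sum>j\<in>J. \<Sum>i\<in>exps. ev (c j * P j i) * bas i)"
    by (simp only: P sum_distrib_left ev_mult mult.assoc)
  also have "\<dots> = (\<Sum>i\<in>exps. ev (\<Sum>j\<in>J. c j * P j i) * bas i)"
    by (subst sum.swap) (simp add: ev_sum sum_distrib_right)
  also have "\<dots> = 0" using c(2) by simp
  finally have rel: "(\<Sum>j\<in>J. ev (c j) * r ^ j) = 0" .
  define k where "k = (LEAST j. j \<in> J \<and> c j \<noteq> 0)"
  have k: "k \<in> J" "c k \<noteq> 0" using c(1) LeastI_ex[of "\<lambda>j. j \<in> J \<and> c j \<noteq> 0"] unfolding k_def by auto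
  have below: "c j = 0" if "j \<in> J" "j < k" for j using not_less_Least that unfolding k_def by blast
  define r' where "r' = (\<Sum>j\<in>{j\<in>J. k < j}. ev (c j) * r ^ (j - k - 1))"
  have "(\<Sum>j\<in>J. ev (c j) * r ^ j) = (\<Sum>j\<in>{j\<in>J. k \<le> j}. ev (c j) * r ^ j)"
    using below J by (intro sum.mono_neutral_right) auto
  also have "{j\<in>J. k \<le> j} = insert k {j\<in>J. k < j}" using k by auto
  also have "(\<Sum>j\<in>insert k {j\<in>J. k < j}. ev (c j) * r ^ j)
      = ev (c k) * r ^ k + (\<Sum>j\<in>{j\<in>J. k < j}. ev (c j) * r ^ j)"
    using J by simp
  also have "(\<Sum>j\<in>{j\<in>J. k < j}. ev (c j) * r ^ j)
      = (\<Sum>j\<in>{j\<in>J. k < j}. r ^ k * (r * (ev (c j) * r ^ (j - k - 1))))"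
  proof (intro sum.cong refl)
    fix j assume "j \<in> {j\<in>J. k < j}"
    then have "r ^ j = r ^ (k + Suc (j - k - 1))" by simp
    then show "ev (c j) * r ^ j = r ^ k * (r * (ev (c j) * r ^ (j - k - 1)))"
      by (simp only: power_add power_Suc mult.left_commute)
  qed
  also have "\<dots> = r ^ k * (r * r')" by (simp add: r'_def sum_distrib_left)
  finally have "r ^ k * (ev (c k) + r * r') = 0" using rel by (simp add: algebra_simps)
  then have "r * r' = ev (- c k)" using r by (simp add: ev_minus eq_neg_iff_add_eq_0 add.commute)
  moreover have "r' \<in> R" unfolding r'_def by (intro R_sum R.mult ev_in_R R_power r)
  ultimately show ?thesis using that[of r' "- c k"] k by simp
qed

text \<open>The functions with a polynomial denominator form a subfield containing the generators;
  closure under inverses comes from \<open>R_divides_ev\<close>.\<close>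

lemma exists_denominator: "\<exists>c r. c \<noteq> 0 \<and> r \<in> R \<and> ev c * f = r"
proof -
  define T where "T = {f. \<exists>c. c \<noteq> 0 \<and> ev c * f \<in> R}"
  have T_R: "r \<in> T" if "r \<in> R" for r
    unfolding T_def using that by (intro CollectI exI[of _ 1]) simp
  have TI: "f \<in> T" if "ev c * f = r" "c \<noteq> 0" "r \<in> R" for c r f
    unfolding T_def using that by blast
  have "is_subfield T"
    unfolding is_subfield_def
  proof (intro conjI ballI impI)
    show "0 \<in> T" "1 \<in> T" using T_R R_0 R_1 by auto
    fix f assume "f \<in> T"
    then obtain c where c: "c \<noteq> 0" "ev c * f \<in> R" unfolding T_def by blast
    show "inverse f \<in> T" if f: "f \<noteq> 0"
    proof -
      have "ev c * f \<noteq> 0" using c f ev_eq_0_iff by simp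
      then obtain r' d where d: "r' \<in> R" "d \<noteq> 0" "ev c * f * r' = ev d" using R_divides_ev c by metis
      have "ev d * inverse f = ev c * r'" unfolding d(3)[symmetric] using f by simp
      then show ?thesis by (rule TI[OF _ d(2)]) (intro R.mult ev_in_R d)
    qed
    fix g assume "g \<in> T"
    then obtain d where d: "d \<noteq> 0" "ev d * g \<in> R" unfolding T_def by blast
    have cd: "c * d \<noteq> 0" using c d by simp
    have eqs: "ev (c * d) * (f + g) = ev d * (ev c * f) + ev c * (ev d * g)"
      "ev (c * d) * (f * g) = (ev c * f) * (ev d * g)"
      "ev (c * d) * (f - g) = ev d * (ev c * f) - ev c * (ev d * g)"
      by (simp_all add: ev_mult algebra_simps)
    note mems = R.mult[OF ev_in_R c(2), of d] R.mult[OF ev_in_R d(2), of c]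
    show "f + g \<in> T" by (rule TI[OF eqs(1) cd R.add[OF mems]])
    show "f * g \<in> T" by (rule TI[OF eqs(2) cd R.mult[OF c(2) d(2)]])
    show "f - g \<in> T" by (rule TI[OF eqs(3) cd R_diff[OF mems]])
  qed
  moreover have "range \<iota> \<subseteq> T" "x \<in> T" "y \<in> T" using T_R R.intros by auto
  ultimately have "T = UNIV" using generated unfolding generated_by_def by blast
  then show ?thesis unfolding T_def by blast
qed

end


subsection \<open>Places at infinity\<close>

context suzuki
begin

text \<open>Zero coefficients are dropped, so that each remaining summand has the pole order of its
  monomial.\<close>

lemma R_combination:
  assumes "r \<in> R"
  obtains T c where "finite T" "T \<subseteq> smons {0,1}" "\<forall>s\<in>T. c s \<noteq> 0" "r = (\<Sum>s\<in>T. \<iota> (c s) * s)"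
proof -
  obtain T c where T: "finite T" "T \<subseteq> smons {0,1}" "r = (\<Sum>s\<in>T. \<iota> (c s) * s)"
    using assms unfolding R_eq_span vs.span_explicit by blast
  have "r = (\<Sum>s\<in>{s\<in>T. c s \<noteq> 0}. \<iota> (c s) * s)"
    unfolding T(3) using T(1) by (intro sum.mono_neutral_right) (auto simp: hom_simps)
  moreover have "finite {s\<in>T. c s \<noteq> 0}" "{s\<in>T. c s \<noteq> 0} \<subseteq> smons {0,1}" using T by auto
  ultimately show ?thesis using that[of "{s\<in>T. c s \<noteq> 0}" c] by blast
qed

definition pole :: "nat \<Rightarrow> nat \<Rightarrow> nat \<Rightarrow> nat \<Rightarrow> nat \<Rightarrow> nat" where
  "pole a b c d s = a * q + b * (q + q0) + c * (q + 2 * q0) + d * (q + 2 * q0 + 1) + s * q\<^sup>2"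

text \<open>The exponents are mixed-radix digits. The last digit to base \<open>q0\<close> is
  \<open>d\<close>, the next to base 2 is \<open>b\<close>, then subtracting \<open>d\<close> leaves
  \<open>c\<close> to base \<open>q0\<close>. What remains is
  \<open>A = a + b + c + d + s * q\<close>, which yields \<open>a\<close> and \<open>s\<close> to
  base \<open>q\<close>.\<close>

lemma pole_inj:
  assumes eq: "pole a b c d s = pole a' b' c' d' s'"
    and bounds: "a < q" "b < 2" "c < q0" "d < q0" "a' < q" "b' < 2" "c' < q0" "d' < q0"
  shows "a = a' \<and> b = b' \<and> c = c' \<and> d = d' \<and> s = s'"
proof -
  have digit: "u = u' \<and> r = r'" if "u * k + r = u' * k + r'" "r < k" "r' < k" for u u' r r' k :: nat
  proof -
    have "(u * k + r) div k = u" "(u * k + r) mod k = r" if "r < k" for u r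
      using that by simp_all
    with that show ?thesis by metis
  qed
  define A A' where "A = a + b + c + d + s * q" and "A' = a' + b' + c' + d' + s' * q"
  have "pole a b c d s = ((q0 * A + c + d) * 2 + b) * q0 + d"
    "pole a' b' c' d' s' = ((q0 * A' + c' + d') * 2 + b') * q0 + d'"
    by (simp_all add: pole_def A_def A'_def q_eq power2_eq_square algebra_simps)
  then have 1: "(q0 * A + c + d) * 2 + b = (q0 * A' + c' + d') * 2 + b'" "d = d'"
    using digit eq bounds by metis+
  then have 2: "q0 * A + c + d = q0 * A' + c' + d'" "b = b'"
    using digit[OF 1(1)] bounds by auto
  then have "A * q0 + c = A' * q0 + c'" using 1 by (simp add: mult.commute)
  then have 3: "A = A'" "c = c'" using digit bounds by blast+
  then have "s * q + a = s' * q + a'" using 1 2 unfolding A_def A'_def by simp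
  then have "s = s'" "a = a'" using digit bounds by blast+
  then show ?thesis using 1 2 3 by simp
qed

end

text \<open>\<open>V\<close> is not assumed to be discrete: Chevalley's theorem does not give this.
  It follows from the computation of pole orders.\<close>

locale suzuki_infinity = suzuki \<iota> x m y z w + valuation_ring V
  for \<iota> :: "'f::{finite,field} \<Rightarrow> 'K::field" and x m y z w and V :: "'K set" +
  assumes const_V: "range \<iota> \<subseteq> V" and x_notin_V: "x \<notin> V"
begin

text \<open>Since \<open>x\<close> has pole order \<open>q\<close>, an element has pole order \<open>n\<close> iff its \<open>q\<close>-th power
is a unit times \<open>x\<close> to the power \<open>n\<close>.\<close>
definition pole_ord :: "'K \<Rightarrow> int \<Rightarrow> bool" where
  "pole_ord f n \<longleftrightarrow> f \<noteq> 0 \<and> f ^ q / x powi n \<in> vunit"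

lemma pole_ord_nonzero: "pole_ord f n \<Longrightarrow> f \<noteq> 0"
  by (simp add: pole_ord_def)

lemma x_powi_vmax: "n < 0 \<Longrightarrow> x powi n \<in> vmax"
  using inverse_in_vmax[OF x_notin_V] power_in_vmax_iff[of "nat (- n)" "inverse x"]
  by (simp add: power_int_def)

lemma pole_ord_mult: "pole_ord f n \<Longrightarrow> pole_ord g k \<Longrightarrow> pole_ord (f * g) (n + k)"
proof -
  assume fg: "pole_ord f n" "pole_ord g k"
  have "(f * g) ^ q / x powi (n + k) = (f ^ q / x powi n) * (g ^ q / x powi k)"
    using x_nonzero by (simp add: power_mult_distrib power_int_add)
  with fg show ?thesis unfolding pole_ord_def by (metis vunit_mult mult_eq_0_iff)
qed

lemma pole_ord_inverse: "pole_ord f n \<Longrightarrow> pole_ord (inverse f) (- n)"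
proof -
  assume f: "pole_ord f n"
  have "inverse f ^ q / x powi (- n) = inverse (f ^ q / x powi n)"
    by (simp add: power_int_minus power_inverse field_simps)
  with f show ?thesis unfolding pole_ord_def by (metis vunit_inverse nonzero_imp_inverse_nonzero)
qed

lemma pole_ord_const: "c \<noteq> 0 \<Longrightarrow> pole_ord (\<iota> c) 0"
proof -
  assume c: "c \<noteq> 0"
  have "\<iota> c * \<iota> (inverse c) = 1" using c hom_simps(2,4) by (metis right_inverse)
  then have "inverse (\<iota> c) = \<iota> (inverse c)" by (rule inverse_unique)
  then have "\<iota> c \<in> vunit" using c const_V by (auto simp: vunit_def hom_simps)
  then show ?thesis using c by (simp add: pole_ord_def vunit_power hom_simps)
qed

lemma pole_ord_1: "pole_ord 1 0"
  using pole_ord_const[of 1] by (simp add: hom_simps)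

lemma pole_ord_power: "pole_ord f n \<Longrightarrow> pole_ord (f ^ k) (int k * n)"
  using pole_ord_mult[of f n] by (induction k) (auto simp: pole_ord_1 distrib_right)

lemma pole_ord_powi: "pole_ord f n \<Longrightarrow> pole_ord (f powi k) (k * n)"
  using pole_ord_power[of f n "nat k"] pole_ord_power[OF pole_ord_inverse, of f n "nat (- k)"]
  by (auto simp: power_int_def)

text \<open>The quotient \<open>g / f\<close> lies in the maximal ideal because its
  \<open>q\<close>-th power does, so \<open>f + g\<close> is \<open>f\<close> times a unit.\<close>

lemma pole_ord_add:
  assumes "pole_ord f n" "pole_ord g k" "k < n"
  shows "pole_ord (f + g) n"
proof -
  have nz: "f \<noteq> 0" "g \<noteq> 0" and u: "f ^ q / x powi n \<in> vunit" "g ^ q / x powi k \<in> vunit"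
    using assms by (auto simp: pole_ord_def)
  have "(g / f) ^ q = (g ^ q / x powi k) / (f ^ q / x powi n) * x powi (k - n)"
    using nz x_nonzero by (simp add: power_int_diff power_divide)
  moreover have "\<dots> \<in> vmax"
    using vunit_subset[OF vunit_divide[OF u(2) u(1)]] x_powi_vmax[of "k - n"] assms(3)
    by (intro vmax_mult) simp_all
  ultimately have "g / f \<in> vmax" using power_in_vmax_iff[of q "g / f"] q_ge_8 by simp
  then have "1 + g / f \<in> vunit" using vunit_add_vmax one_in_vunit by blast
  moreover have eq: "f + g = f * (1 + g / f)" using nz by (simp add: field_simps)
  moreover have "(f + g) ^ q / x powi n = (1 + g / f) ^ q * (f ^ q / x powi n)"
    unfolding eq by (simp add: power_mult_distrib)
  ultimately show ?thesis unfolding pole_ord_def using u nz vunit_mult vunit_power vunit_nonzero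
    by (metis mult_eq_0_iff)
qed

lemma pole_ord_unique:
  assumes "pole_ord f n" "pole_ord f k"
  shows "n = k"
proof -
  have "n \<le> k" if fn: "pole_ord f n" and fk: "pole_ord f k" for n k
  proof (rule ccontr)
    assume "\<not> n \<le> k"
    then have "x powi (k - n) \<in> vmax" by (intro x_powi_vmax) simp
    moreover have "x powi (k - n) = (f ^ q / x powi n) / (f ^ q / x powi k)"
      using fn x_nonzero by (simp add: power_int_diff pole_ord_def)
    ultimately show False using fn fk vunit_divide vmax_not_vunit unfolding pole_ord_def by metis
  qed
  then show ?thesis using assms by (meson order_antisym)
qed

lemma pole_ord_sum:
  assumes "finite I" "I \<noteq> {}" "\<And>i. i \<in> I \<Longrightarrow> pole_ord (f i) (n i)" "inj_on n I"
  shows "\<exists>j\<in>I. pole_ord (sum f I) (n j) \<and> (\<forall>i\<in>I. n i \<le> n j)"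
  using assms
proof (induction I rule: finite_ne_induct)
  case (insert a F)
  then obtain j where j: "j \<in> F" "pole_ord (sum f F) (n j)" "\<forall>i\<in>F. n i \<le> n j" by auto
  have a: "pole_ord (f a) (n a)" using insert.prems by simp
  have "n a \<noteq> n j" using insert.prems(2) insert.hyps j by (auto simp: inj_on_def)
  then consider "n a < n j" | "n j < n a" by linarith
  then show ?case
  proof cases
    case 1
    then show ?thesis using pole_ord_add[OF j(2) a 1] insert.hyps j by (auto simp: add.commute)
  next
    case 2
    then show ?thesis using pole_ord_add[OF a j(2) 2] insert.hyps j by force
  qed
qed auto

lemma pole_ord_pos_notin_V:
  assumes "pole_ord f n" "n > 0"
  shows "f \<notin> V"
proof
  assume "f \<in> V"
  have u: "f ^ q / x powi n \<in> vunit" "f \<noteq> 0" using assms by (auto simp: pole_ord_def)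
  have "x powi n = f ^ q * inverse (f ^ q / x powi n)" using u by simp
  then have "x powi n \<in> V"
    using ring_closed(5,7) \<open>f \<in> V\<close> vunit_subset vunit_inverse u by metis
  moreover have "x powi (- n) \<in> vmax" using assms by (intro x_powi_vmax) simp
  ultimately show False using x_nonzero by (simp add: vmax_iff power_int_minus)
qed

text \<open>Since \<open>a\<close> has a pole, \<open>a ^ q\<close> dominates \<open>a\<close>, and
  \<open>b / a ^ q\<close> is a unit. Hence the pole order of \<open>b\<close> is \<open>q\<close>
  times that of \<open>a\<close>.\<close>

lemma pole_ord_artin_schreier:
  assumes eq: "a ^ q + a = b" and b: "pole_ord b (int q * n)" and n: "n > 0"
  shows "pole_ord a n"
proof -
  have "b \<notin> V" using pole_ord_pos_notin_V[OF b] n q_ge_8 by simp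
  then have "a \<notin> V" using ring_closed(6,7) eq by blast
  then have a0: "a \<noteq> 0" using ring_closed(1) by auto
  have b0: "b \<noteq> 0" using b pole_ord_nonzero by blast
  have "inverse a ^ (q - 1) \<in> vmax"
    using inverse_in_vmax[OF \<open>a \<notin> V\<close>] power_in_vmax_iff[of "q - 1"] q_ge_8 by simp
  then have "1 + inverse a ^ (q - 1) \<in> vunit" using vunit_add_vmax one_in_vunit by blast
  moreover have "b / a ^ q = 1 + inverse a ^ (q - 1)"
  proof -
    have "a ^ q = a ^ (q - 1) * a" using q_ge_8 by (metis power_minus_mult not_numeral_le_zero gr0I)
    then show ?thesis using a0 unfolding eq[symmetric] by (simp add: field_simps)
  qed
  ultimately have "b / a ^ q \<in> vunit" by (simp only:)
  from vunit_inverse[OF this] have "a ^ q / b \<in> vunit" by simp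
  then have "(a ^ q / b) ^ q * (b ^ q / x powi (int q * n)) \<in> vunit"
    using b vunit_mult vunit_power unfolding pole_ord_def by blast
  moreover have "(a ^ q / b) ^ q * (b ^ q / x powi (int q * n)) = (a ^ q / x powi n) ^ q"
    using b0 by (simp add: power_divide power_int_mult mult.commute[of "int q"])
  ultimately have "a ^ q / x powi n \<in> vunit" using power_in_vunit_iff q_ge_8 by (metis gr0I not_numeral_le_zero)
  then show ?thesis using a0 by (simp add: pole_ord_def)
qed

lemma pole_ord_x: "pole_ord x (int q)"
  using one_in_vunit x_nonzero by (simp add: pole_ord_def)

lemma pole_ord_X: "pole_ord X (int q * int q)"
  unfolding X_def using pole_ord_add[OF pole_ord_power[OF pole_ord_x, of q] pole_ord_x] q_ge_8 by simp

lemma pole_ord_y: "pole_ord y (int (q + q0))"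
proof (rule pole_ord_artin_schreier)
  show "y ^ q + y = x ^ q0 * X" using y_power_q by (simp add: char2_algebra)
  have "int q0 * int q + int q * int q = int q * int (q + q0)" by (simp add: algebra_simps)
  then show "pole_ord (x ^ q0 * X) (int q * int (q + q0))"
    using pole_ord_mult[OF pole_ord_power[OF pole_ord_x, of q0] pole_ord_X] by simp
qed (use q_ge_8 in simp)

lemma pole_ord_z: "pole_ord z (int (q + 2 * q0))"
proof (rule pole_ord_artin_schreier)
  show "z ^ q + z = x ^ (2 * q0) * X" using z_power_q by (simp add: char2_algebra)
  have "int (2 * q0) * int q + int q * int q = int q * int (q + 2 * q0)" by (simp add: algebra_simps)
  then show "pole_ord (x ^ (2 * q0) * X) (int q * int (q + 2 * q0))"
    using pole_ord_mult[OF pole_ord_power[OF pole_ord_x, of "2 * q0"] pole_ord_X] by simp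
qed (use q_ge_8 in simp)

lemma pole_ord_w: "pole_ord w (int (q + 2 * q0 + 1))"
proof (rule pole_ord_artin_schreier)
  show "w ^ q + w = y ^ (2 * q0) * X" using w_power_q by (simp add: char2_algebra)
  have "int (2 * q0) * int (q + q0) + int q * int q = int q * int (q + 2 * q0 + 1)"
    by (simp add: q_eq algebra_simps)
  then show "pole_ord (y ^ (2 * q0) * X) (int q * int (q + 2 * q0 + 1))"
    using pole_ord_mult[OF pole_ord_power[OF pole_ord_y, of "2 * q0"] pole_ord_X] by simp
qed (use q_ge_8 in simp)

lemma pole_ord_smon: "pole_ord (smon a b c d s) (int (pole a b c d s))"
proof -
  have "int (pole a b c d s) = int a * int q + int b * int (q + q0) + int c * int (q + 2 * q0)
      + int d * int (q + 2 * q0 + 1) + int s * (int q * int q)"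
    by (simp add: pole_def power2_eq_square algebra_simps)
  then show ?thesis unfolding smon_def
    by (simp only:) (intro pole_ord_mult pole_ord_power pole_ord_x pole_ord_y pole_ord_z pole_ord_w pole_ord_X)
qed

text \<open>Distinct monomials have distinct pole orders, so the largest one in a combination
  survives.\<close>

lemma pole_ord_R:
  assumes "r \<in> R" "r \<noteq> 0"
  shows "\<exists>n. pole_ord r n"
proof -
  obtain T c where T: "finite T" "T \<subseteq> smons {0,1}" "\<forall>s\<in>T. c s \<noteq> 0"
      and r: "r = (\<Sum>s\<in>T. \<iota> (c s) * s)"
    by (rule R_combination[OF assms(1)])
  have "\<exists>n. pole_ord s n" if "s \<in> smons {0,1}" for s
    using that by (auto elim!: smonsE intro: pole_ord_smon)
  then obtain n where n: "\<And>s. s \<in> smons {0,1} \<Longrightarrow> pole_ord s (n s)" by metis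
  have inj: "s = s'" if ss: "s \<in> smons {0,1}" "s' \<in> smons {0,1}" "n s = n s'" for s s'
  proof -
    obtain a b c d e where s: "s = smon a b c d e" "a < q" "b \<in> {0,1}" "c < q0" "d < q0"
      using ss(1) by (rule smonsE)
    obtain a' b' c' d' e' where s': "s' = smon a' b' c' d' e'" "a' < q" "b' \<in> {0,1}" "c' < q0" "d' < q0"
      using ss(2) by (rule smonsE)
    have "int (pole a b c d e) = int (pole a' b' c' d' e')"
      using pole_ord_unique[OF n pole_ord_smon] ss s(1) s'(1) by metis
    then show ?thesis using pole_inj[of a b c d e a' b' c' d' e'] s s' by auto
  qed
  have "T \<noteq> {}" using r assms(2) by auto
  moreover have "pole_ord (\<iota> (c s) * s) (n s)" if "s \<in> T" for s
    using pole_ord_mult[OF pole_ord_const n, of "c s" s] that T by auto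
  moreover have "inj_on n T" using inj T by (auto simp: inj_on_def)
  ultimately show ?thesis using pole_ord_sum[of T "\<lambda>s. \<iota> (c s) * s" n] T unfolding r by blast
qed

lemma pole_ord_exists:
  assumes "f \<noteq> 0"
  shows "\<exists>n. pole_ord f n"
proof -
  obtain c r where c: "c \<noteq> 0" "r \<in> R" "ev c * f = r" using exists_denominator by blast
  have nz: "ev c \<noteq> 0" using c ev_eq_0_iff by blast
  then have "f = r * inverse (ev c)" "r \<noteq> 0" using c assms by (auto simp: field_simps)
  then show ?thesis
    using pole_ord_R[OF c(2)] pole_ord_R[OF ev_in_R nz] pole_ord_mult pole_ord_inverse by metis
qed

text \<open>A local parameter at infinity: by q = 2 * q0^2, the exponents satisfy (2 * q0 - 1) * (q
  + 2 * q0 + 1) - (2 * q0 + 1) * q = -1.\<close>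

definition unif :: 'K where "unif = w ^ (2 * q0 - 1) / x ^ (2 * q0 + 1)"

lemma pole_ord_unif: "pole_ord unif (- 1)"
proof -
  have "int (2 * q0 - 1) = 2 * int q0 - 1" using q0_ge_2 by simp
  then have "int (2 * q0 - 1) * int (q + 2 * q0 + 1) + - (int (2 * q0 + 1) * int q) = - 1"
    by (simp add: q_eq algebra_simps)
  then show ?thesis unfolding unif_def divide_inverse
    using pole_ord_mult[OF pole_ord_power[OF pole_ord_w] pole_ord_inverse[OF pole_ord_power[OF pole_ord_x]],
        of "2 * q0 - 1" "2 * q0 + 1"] by simp
qed

text \<open>A function of pole order \<open>k\<close> times the \<open>k\<close>-th power of
  \<open>unif\<close> has pole order 0 and is a unit, so \<open>unif\<close> is a
  uniformizer.\<close>

lemma exists_place: "\<exists>v. is_place \<iota> v \<and> v x < 0"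
proof -
  have unit: "f \<in> vunit" if "pole_ord f 0" for f
    using that power_in_vunit_iff[of q f] q_ge_8 by (simp add: pole_ord_def)
  have "unif \<in> vmax"
  proof -
    have "(unif ^ q / x powi (- 1)) * x powi (- 1) \<in> vmax"
      using pole_ord_unif by (intro vmax_mult vunit_subset x_powi_vmax) (auto simp: pole_ord_def)
    then show ?thesis using power_in_vmax_iff[of q unif] q_ge_8 x_nonzero by simp
  qed
  moreover have "\<exists>n::int. f / unif powi n \<in> vunit" if f: "f \<noteq> 0" for f
  proof -
    obtain k where k: "pole_ord f k" using pole_ord_exists[OF f] by blast
    have "pole_ord (f * inverse (unif powi (- k))) (k + - (- k * - 1))"
      by (intro pole_ord_mult pole_ord_inverse pole_ord_powi pole_ord_unif k)
    then show ?thesis using unit by (intro exI[of _ "- k"]) (simp add: divide_inverse)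
  qed
  ultimately obtain v where "is_place \<iota> v" "\<And>f. f \<noteq> 0 \<Longrightarrow> 0 \<le> v f \<longleftrightarrow> f \<in> V"
    using uniformizer_imp_place[OF hom const_V, of unif] pole_ord_nonzero[OF pole_ord_unif] by metis
  then show ?thesis using x_notin_V x_nonzero by (metis linorder_not_le)
qed

end

context suzuki
begin

text \<open>\<open>A\<close> is the ring of polynomials in 1/x. By transcendence it does not contain
  \<open>x\<close>, so Chevalley's theorem provides a valuation ring in which \<open>x\<close> has a
  pole.\<close>

lemma exists_place_at_infinity: "\<exists>v. is_place \<iota> v \<and> v x < 0"
proof -
  define A where "A = {ev p / x ^ n | p n. degree p \<le> n}"
  have AI: "f \<in> A" if "f = ev p / x ^ n" "degree p \<le> n" for f p n
    unfolding A_def using that by blast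
  have sub: "subring_of_field A"
    unfolding subring_of_field_def
  proof (intro conjI ballI)
    show "1 \<in> A" by (rule AI[of _ 1 0]) auto
    fix f g assume "f \<in> A" "g \<in> A"
    then obtain p n p' n' where fg: "f = ev p / x ^ n" "degree p \<le> n" "g = ev p' / x ^ n'" "degree p' \<le> n'"
      unfolding A_def by blast
    show "f * g \<in> A"
      by (rule AI[of _ "p * p'" "n + n'"])
        (use fg degree_mult_le[of p p'] in \<open>auto simp: ev_mult power_add\<close>)
    have "degree (p * monom 1 n' - p' * monom 1 n) \<le> n + n'"
      using fg degree_mult_le[of p "monom 1 n'"] degree_mult_le[of p' "monom 1 n"]
      by (intro degree_diff_le) (auto simp: degree_monom_eq)
    moreover have "f - g = ev (p * monom 1 n' - p' * monom 1 n) / x ^ (n + n')"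
      unfolding fg(1,3) using x_nonzero
      by (simp add: ev_diff ev_mult ev_monom hom_simps power_add field_simps)
    ultimately show "f - g \<in> A" using AI by blast
  qed
  have inv_x: "inverse x \<in> A" by (rule AI[of _ 1 1]) (auto simp: divide_inverse)
  have "inverse (inverse x) \<notin> A"
  proof
    assume "inverse (inverse x) \<in> A"
    then obtain p n where p: "x = ev p / x ^ n" "degree p \<le> n" unfolding A_def by auto
    then have "ev (monom 1 (Suc n) - p) = 0"
      using x_nonzero by (simp add: ev_diff ev_monom hom_simps field_simps)
    then have "p = monom 1 (Suc n)" using ev_eq_0_iff by simp
    then show False using p(2) by (simp add: degree_monom_eq)
  qed
  from exists_valuation_ring[OF sub inv_x this] obtain V where
    V: "valuation_ring V" "A \<subseteq> V" "x \<notin> V" by auto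
  have "range \<iota> \<subseteq> V"
  proof -
    have "\<iota> c \<in> A" for c by (rule AI[of _ "[:c:]" 0]) auto
    then show ?thesis using V(2) by blast
  qed
  then have "suzuki_infinity \<iota> x m y z w V"
    using V by (intro suzuki_infinity.intro suzuki_axioms suzuki_infinity_axioms.intro)
  then show ?thesis by (rule suzuki_infinity.exists_place)
qed

end

section \<open>Values and residues at an arbitrary place at infinity\<close>

locale suzuki_inf_place = suzuki \<iota> x m y z w + place \<iota> v
  for \<iota> :: "'f::{finite,field} \<Rightarrow> 'K::field" and x m y z w and v :: "'K \<Rightarrow> int" +
  assumes x_neg: "v x < 0"
begin

lemma suzuki_infinity_of_place: "suzuki_infinity \<iota> x m y z w {f. val_ge v f 0}"
proof (intro suzuki_infinity.intro suzuki_axioms suzuki_infinity_axioms.intro valuation_ring_of_place)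
  show "range \<iota> \<subseteq> {f. val_ge v f 0}" using val_ge_const by blast
  show "x \<notin> {f. val_ge v f 0}" using x_neg x_nonzero by (simp add: val_ge_def)
qed

interpretation inf: suzuki_infinity \<iota> x m y z w "{f. val_ge v f 0}"
  by (rule suzuki_infinity_of_place)

text \<open>A function of pole order \<open>n\<close> satisfies
  \<open>int q * v f = n * v x\<close>, which determines \<open>v\<close> up to scaling. A function
  of value 1 fixes the scale: it forces \<open>unif\<close> to have value 1, hence
  \<open>v x = - int q\<close>.\<close>

lemma val_smon: "v (smon a b c d s) = - int (pole a b c d s)"
proof -
  have pole_val: "int q * v f = n * v x" if "inf.pole_ord f n" for f n
  proof -
    have "f ^ q / x powi n \<in> inf.vunit" "f \<noteq> 0" using that by (auto simp: inf.pole_ord_def)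
    then have "v (f ^ q / x powi n) = 0" using vunit_of_place by blast
    then show ?thesis using \<open>f \<noteq> 0\<close> x_nonzero by (simp add: val_divide val_power val_powi)
  qed
  obtain f where f: "f \<noteq> 0" "v f = 1" using val_surj by blast
  obtain n where n: "inf.pole_ord f n" using inf.pole_ord_exists[OF f(1)] by blast
  have vx: "v x = - (int q * v inf.unif)" using pole_val[OF inf.pole_ord_unif] by simp
  have q: "int q > 0" using q_ge_8 by simp
  have "int q * 1 = int q * (- n * v inf.unif)" using pole_val[OF n] f vx by (simp add: algebra_simps)
  then have "- n * v inf.unif = 1" using q by (metis mult_cancel_left less_irrefl)
  moreover have "v inf.unif > 0" using x_neg vx q by (simp add: zero_less_mult_iff)
  ultimately have "v inf.unif = 1" by (metis mult.commute pos_zmult_eq_1_iff)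
  then have "v x = - int q" using vx by simp
  then have "int q * v (smon a b c d s) = int q * - int (pole a b c d s)"
    using pole_val[OF inf.pole_ord_smon, of a b c d s] by simp
  then show ?thesis using q by (metis mult_cancel_left less_irrefl)
qed

lemma smon_nonzero: "smon a b c d s \<noteq> 0"
  using inf.pole_ord_nonzero inf.pole_ord_smon by blast

lemma val_smons_inj:
  assumes "s \<in> smons {0,1}" "s' \<in> smons {0,1}" "v s = v s'"
  shows "s = s'"
proof -
  obtain a b c d e where s: "s = smon a b c d e" "a < q" "b \<in> {0,1}" "c < q0" "d < q0"
    using assms(1) by (rule smonsE)
  obtain a' b' c' d' e' where s': "s' = smon a' b' c' d' e'" "a' < q" "b' \<in> {0,1}" "c' < q0" "d' < q0"
    using assms(2) by (rule smonsE)
  have "pole a b c d e = pole a' b' c' d' e'" using assms(3) unfolding s s' val_smon by simp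
  then show ?thesis using pole_inj[of a b c d e a' b' c' d' e'] s s' by auto
qed

lemma val_smon_combination:
  assumes "finite T" "T \<subseteq> smons {0,1}" "\<forall>s\<in>T. c s \<noteq> 0" "T \<noteq> {}"
  defines "r \<equiv> \<Sum>s\<in>T. \<iota> (c s) * s"
  shows "\<exists>t\<in>T. r \<noteq> 0 \<and> v r = v t \<and> (\<forall>s\<in>T. s \<noteq> t \<longrightarrow> v t < v s)"
proof -
  have nz: "s \<noteq> 0" if "s \<in> T" for s using that assms(2) smon_nonzero by (auto elim!: smonsE)
  have val: "v (\<iota> (c s) * s) = v s" if "s \<in> T" for s
    using that nz assms(3) by (simp add: val_mult val_const hom_simps)
  have "inj_on (\<lambda>s. v (\<iota> (c s) * s)) T"
    using val val_smons_inj assms(2) by (auto simp: inj_on_def)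
  from val_sum_distinct[OF assms(1,4) _ this] obtain t where
    "t \<in> T" "r \<noteq> 0" "v r = v (\<iota> (c t) * t)" "\<And>s. s \<in> T \<Longrightarrow> s \<noteq> t \<Longrightarrow> v (\<iota> (c t) * t) < v (\<iota> (c s) * s)"
    using nz assms(3) unfolding r_def by (auto simp: hom_simps)
  then show ?thesis using val by (intro bexI[of _ t]) auto
qed

lemma leading_smon:
  assumes "r \<in> R" "r \<noteq> 0"
  obtains t k where "t \<in> smons {0,1}" "k \<noteq> 0" "v r = v t" "val_ge v (r - \<iota> k * t) (v t + 1)"
proof -
  obtain T c where T: "finite T" "T \<subseteq> smons {0,1}" "\<forall>s\<in>T. c s \<noteq> 0" "r = (\<Sum>s\<in>T. \<iota> (c s) * s)"
    by (rule R_combination[OF assms(1)])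
  then have "T \<noteq> {}" using assms(2) by auto
  from val_smon_combination[OF T(1,2,3) this] obtain t where t: "t \<in> T" "v r = v t"
      "\<And>s. s \<in> T \<Longrightarrow> s \<noteq> t \<Longrightarrow> v t < v s"
    unfolding T(4) by blast
  have "r - \<iota> (c t) * t = (\<Sum>s\<in>T - {t}. \<iota> (c s) * s)"
    unfolding T(4) using T(1) t(1) by (simp add: sum.remove)
  moreover have "val_ge v (\<Sum>s\<in>T - {t}. \<iota> (c s) * s) (v t + 1)"
    by (intro val_ge_sum val_ge_scale) (use t(3) in \<open>force simp: val_ge_def\<close>)
  ultimately show ?thesis using that[of t "c t"] t T by auto
qed

text \<open>If a fraction of elements of \<open>R\<close> has value 0, numerator and denominator
  have the same leading monomial, because values determine monomials. The quotient of the leading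
  coefficients is the residue.\<close>

lemma rational: "is_rational_place \<iota> v"
  unfolding is_rational_place_def
proof (intro conjI allI impI place)
  fix f assume f: "f \<noteq> 0" "v f \<ge> 0"
  obtain p r where p: "p \<noteq> 0" "r \<in> R" "ev p * f = r" using exists_denominator by blast
  define e where "e = ev p"
  have e: "e \<in> R" "e \<noteq> 0" using ev_in_R p ev_eq_0_iff by (auto simp: e_def)
  have r: "r \<noteq> 0" "f = r / e" using p e f by (auto simp: e_def field_simps)
  show "\<exists>c. f = \<iota> c \<or> (f - \<iota> c \<noteq> 0 \<and> v (f - \<iota> c) > 0)"
  proof (cases "v f = 0")
    case False
    then show ?thesis using f by (intro exI[of _ 0]) (simp add: hom_simps)
  next
    case True
    then have "v r = v e" using r e by (simp add: val_divide)
    obtain t k where t: "t \<in> smons {0,1}" "k \<noteq> 0" "v r = v t" "val_ge v (r - \<iota> k * t) (v t + 1)"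
      using leading_smon[OF p(2) r(1)] .
    obtain t' k' where t': "t' \<in> smons {0,1}" "k' \<noteq> 0" "v e = v t'" "val_ge v (e - \<iota> k' * t') (v t' + 1)"
      using leading_smon[OF e] .
    have tt: "t' = t" using val_smons_inj t t' \<open>v r = v e\<close> by simp
    define c where "c = k / k'"
    have "\<iota> c * \<iota> k' = \<iota> k" using t'(2) by (simp add: c_def flip: hom_simps)
    then have "r - \<iota> c * e = (r - \<iota> k * t) - \<iota> c * (e - \<iota> k' * t)"
      by (simp add: algebra_simps)
    moreover have "val_ge v (\<iota> c * (e - \<iota> k' * t)) (v t + 1)" using t'(4) tt val_ge_scale by simp
    ultimately have "val_ge v (r - \<iota> c * e) (v e + 1)"
      using val_ge_diff[OF t(4)] t'(3) tt by (simp only:)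
    moreover have "f - \<iota> c = (r - \<iota> c * e) / e" using r e by (simp add: field_simps)
    ultimately have "f = \<iota> c \<or> (f - \<iota> c \<noteq> 0 \<and> v (f - \<iota> c) > 0)"
      using e val_divide[of "r - \<iota> c * e" e] by (cases "r - \<iota> c * e = 0") (auto simp: val_ge_def)
    then show ?thesis by blast
  qed
qed

end


subsection \<open>Finite places\<close>

text \<open>If \<open>a\<close> had a pole, \<open>a ^ n + a\<close> would be \<open>a ^ n\<close>
  times a unit, so \<open>a ^ n\<close> and with it \<open>a\<close> would lie in
  \<open>V\<close>.\<close>

lemma (in valuation_ring) artin_schreier_in_V:
  assumes "a ^ n + a \<in> V" "n \<ge> 2"
  shows "a \<in> V"
proof (rule ccontr)
  assume a: "a \<notin> V"
  then have a0: "a \<noteq> 0" using ring_closed(1) by auto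
  have "inverse a ^ (n - 1) \<in> vmax"
    using inverse_in_vmax[OF a] power_in_vmax_iff[of "n - 1" "inverse a"] assms(2) by simp
  then have u: "1 + inverse a ^ (n - 1) \<in> vunit" using vunit_add_vmax one_in_vunit by blast
  have "a ^ n = a ^ (n - 1) * a" using assms(2) by (cases n) auto
  then have "a ^ n + a = a ^ n * (1 + inverse a ^ (n - 1))" using a0 by (simp add: field_simps)
  then have "a ^ n = (a ^ n + a) * inverse (1 + inverse a ^ (n - 1))" using vunit_nonzero[OF u] by simp
  also have "\<dots> \<in> V" using ring_closed(5)[OF assms(1) vunit_subset[OF vunit_inverse[OF u]]] .
  finally show False using power_in_V_imp a assms(2) by auto
qed

context suzuki
begin

lemma q_power_eq: "q ^ n = 2 ^ ((2 * m + 1) * n)"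
  unfolding suz_q_def by (rule power_mult[symmetric])

lemma frob_q_power: "((a::'K) + b) ^ (q ^ n) = a ^ (q ^ n) + b ^ (q ^ n)"
  unfolding q_power_eq by (rule char2_power_add[OF char2])

lemma const_power_q_power: "\<iota> c ^ (q ^ n) = \<iota> c"
  by (induction n) (simp_all add: power_mult const_power_q)

section \<open>Frobenius on \<open>R\<close> modulo a polynomial in \<open>x\<close>\<close>

definition pideal :: "'f poly \<Rightarrow> 'K set" where "pideal p = {ev p * r | r. r \<in> R}"

lemma pidealI: "r \<in> R \<Longrightarrow> ev p * r \<in> pideal p"
  unfolding pideal_def by blast

lemma pideal_add: "f \<in> pideal p \<Longrightarrow> g \<in> pideal p \<Longrightarrow> f + g \<in> pideal p"
  unfolding pideal_def using R.add by (force simp flip: distrib_left)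

lemma pideal_mult: "f \<in> pideal p \<Longrightarrow> g \<in> R \<Longrightarrow> f * g \<in> pideal p"
  unfolding pideal_def using R.mult by (force simp: mult.assoc)

lemma pideal_mult': "g \<in> R \<Longrightarrow> f \<in> pideal p \<Longrightarrow> g * f \<in> pideal p"
  using pideal_mult by (simp add: mult.commute)

lemma pideal_0: "0 \<in> pideal p"
  using pidealI[OF R_0, of p] by simp

lemma pideal_sum: "(\<And>i. i \<in> I \<Longrightarrow> f i \<in> pideal p) \<Longrightarrow> sum f I \<in> pideal p"
  by (induction I rule: infinite_finite_induct) (auto intro: pideal_0 pideal_add)

lemma pideal_subset: "f \<in> pideal p \<Longrightarrow> f \<in> R"
  unfolding pideal_def using R.mult ev_in_R by auto

lemma pideal_power: "f \<in> pideal p \<Longrightarrow> n > 0 \<Longrightarrow> f ^ n \<in> pideal p"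
  using pideal_mult[of f p "f ^ (n - 1)"] R_power[OF pideal_subset] by (cases n) auto

lemma ev_in_pideal: "p dvd r \<Longrightarrow> ev r \<in> pideal p"
  by (auto simp: ev_mult intro!: pidealI ev_in_R elim!: dvdE)

text \<open>The elements whose residue is fixed by the \<open>q ^ n\<close>-th power map; the
  difference is written as a sum because the characteristic is 2.\<close>

definition frob_fixed :: "'f poly \<Rightarrow> nat \<Rightarrow> 'K set" where
  "frob_fixed p n = {g \<in> R. g ^ (q ^ n) + g \<in> pideal p}"

lemma frob_fixed_const: "\<iota> c \<in> frob_fixed p n"
  by (simp add: frob_fixed_def R.const const_power_q_power add_self pideal_0)

lemma frob_fixed_add: "f \<in> frob_fixed p n \<Longrightarrow> g \<in> frob_fixed p n \<Longrightarrow> f + g \<in> frob_fixed p n"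
  using pideal_add[of "f ^ (q ^ n) + f" p "g ^ (q ^ n) + g"]
  by (simp add: frob_fixed_def R.add frob_q_power add_ac)

lemma frob_fixed_mult: "f \<in> frob_fixed p n \<Longrightarrow> g \<in> frob_fixed p n \<Longrightarrow> f * g \<in> frob_fixed p n"
proof -
  assume fg: "f \<in> frob_fixed p n" "g \<in> frob_fixed p n"
  have "(f * g) ^ (q ^ n) + f * g
      = (f ^ (q ^ n) + f) * g ^ (q ^ n) + f * (g ^ (q ^ n) + g)"
    by (simp add: power_mult_distrib char2_algebra)
  moreover have "(f ^ (q ^ n) + f) * g ^ (q ^ n) \<in> pideal p" "f * (g ^ (q ^ n) + g) \<in> pideal p"
    using fg pideal_mult pideal_mult' R_power by (auto simp: frob_fixed_def)
  ultimately show ?thesis using fg pideal_add by (simp add: frob_fixed_def R.mult)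
qed

lemma frob_fixed_power: "f \<in> frob_fixed p n \<Longrightarrow> f ^ k \<in> frob_fixed p n"
  using frob_fixed_const[of 1] by (induction k) (auto simp: hom_simps frob_fixed_mult)

lemma frob_fixed_double: "g \<in> frob_fixed p n \<Longrightarrow> g \<in> frob_fixed p (2 * n)"
proof -
  assume g: "g \<in> frob_fixed p n"
  have "g ^ (q ^ (2 * n)) = (g ^ (q ^ n)) ^ (q ^ n)"
    by (simp add: mult_2 power_add power_mult)
  then have "g ^ (q ^ (2 * n)) + g = (g ^ (q ^ n) + g) ^ (q ^ n) + (g ^ (q ^ n) + g)"
    by (simp add: frob_q_power char2_algebra)
  moreover have "g ^ (q ^ n) + g \<in> pideal p" "q ^ n > 0" using g q_ge_8 by (auto simp: frob_fixed_def)
  then have "(g ^ (q ^ n) + g) ^ (q ^ n) + (g ^ (q ^ n) + g) \<in> pideal p"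
    using pideal_add pideal_power by blast
  ultimately have "g ^ (q ^ (2 * n)) + g \<in> pideal p" by (simp only:)
  then show ?thesis using g by (simp add: frob_fixed_def)
qed

lemma R_subset_frob_fixed:
  assumes "x \<in> frob_fixed p n" "y \<in> frob_fixed p n"
  shows "R \<subseteq> frob_fixed p n"
proof
  fix r assume "r \<in> R"
  then show "r \<in> frob_fixed p n"
    by (induction rule: R.induct) (auto intro: assms frob_fixed_const frob_fixed_add frob_fixed_mult)
qed

lemma y_power_q_power: "y ^ (q ^ n) = y + (\<Sum>i<n. (x ^ q0 * X) ^ (q ^ i))"
proof (induction n)
  case (Suc n)
  have "y ^ (q ^ Suc n) = (y ^ q) ^ (q ^ n)" by (simp add: power_mult)
  also have "\<dots> = y ^ (q ^ n) + (x ^ q0 * X) ^ (q ^ n)" by (simp only: y_power_q frob_q_power)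
  finally show ?case using Suc by (simp add: add.assoc)
qed simp

text \<open>The sum over twice as many Frobenius twists telescopes in pairs because the characteristic is 2.\<close>
lemma R_frob_fixed:
  assumes "x \<in> frob_fixed p k"
  shows "R \<subseteq> frob_fixed p (2 * k)"
proof (rule R_subset_frob_fixed)
  show "x \<in> frob_fixed p (2 * k)" by (rule frob_fixed_double[OF assms])
  define u where "u = x ^ q0 * X"
  have "u \<in> frob_fixed p k"
    unfolding u_def X_def by (intro frob_fixed_mult frob_fixed_add frob_fixed_power assms)
  then have u: "u ^ (q ^ k) + u \<in> pideal p" by (simp add: frob_fixed_def)
  have "(\<Sum>i<2 * k. u ^ (q ^ i)) = (\<Sum>i<k. u ^ (q ^ i)) + (\<Sum>i<k. u ^ (q ^ (i + k)))"
    by (simp add: mult_2 lessThan_atLeast0 sum.atLeastLessThan_concat[of 0 k "k + k", symmetric]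
        sum.shift_bounds_nat_ivl[of _ 0 k k, simplified])
  also have "\<dots> = (\<Sum>i<k. (u ^ (q ^ k) + u) ^ (q ^ i))"
    by (simp add: frob_q_power sum.distrib power_add power_mult[symmetric] mult.commute add.commute)
  finally have "(\<Sum>i<2 * k. u ^ (q ^ i)) = (\<Sum>i<k. (u ^ (q ^ k) + u) ^ (q ^ i))" .
  moreover have "\<dots> \<in> pideal p"
    using u q_ge_8 by (intro pideal_sum pideal_power) auto
  moreover have "y ^ (q ^ (2 * k)) + y = (\<Sum>i<2 * k. u ^ (q ^ i))"
    unfolding y_power_q_power u_def by (simp add: add.assoc add.commute[of _ y] add_self_left)
  ultimately show "y \<in> frob_fixed p (2 * k)"
    unfolding frob_fixed_def by (simp add: R.y)
qed

lemma char2_poly: "(2 :: 'f poly) = 0"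
proof -
  have "ev (1 + 1) = 0" unfolding ev_add by (simp add: char2)
  then have "(1::'f poly) + 1 = 0" unfolding ev_eq_0_iff .
  then show ?thesis by simp
qed

text \<open>There are finitely many residues modulo \<open>p\<close>, so two iterated Frobenius
  powers of the variable T agree. Their difference is a Frobenius power of T^(q^k) - T, and
  \<open>p\<close> is prime, so \<open>p\<close> divides this base.\<close>

lemma x_frob_fixed:
  assumes "irreducible p" "degree p > 0"
  shows "\<exists>k>0. x \<in> frob_fixed p k"
proof -
  define F where "F i = monom (1::'f) (q ^ i) mod p" for i
  have "degree (F i) < degree p" for i
    using assms(2) degree_mod_less'[of p "monom 1 (q ^ i)"] unfolding F_def
    by (cases "monom 1 (q ^ i) mod p = 0"; cases "p = 0") auto
  then have "range F \<subseteq> {r. degree r < degree p}" by blast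
  then have "finite (range F)" using finite_degree_less finite_subset by blast
  then have "\<not> inj F" using finite_imageD infinite_UNIV_nat by blast
  then obtain i j where ij: "F i = F j" "i < j"
    unfolding inj_def by (metis linorder_neqE_nat)
  define k where "k = j - i"
  have "p dvd monom 1 (q ^ j) - monom 1 (q ^ i)"
    using ij(1)[symmetric] unfolding F_def by (simp add: mod_eq_dvd_iff)
  also have "monom (1::'f) (q ^ j) - monom 1 (q ^ i) = (monom 1 (q ^ k) - monom 1 1) ^ (q ^ i)"
  proof -
    have "q ^ j = q ^ k * q ^ i" using ij(2) by (simp add: k_def flip: power_add)
    then show ?thesis
      unfolding q_power_eq[of i] char2_power_diff[OF char2_poly] by (simp add: monom_power)
  qed
  finally have "p dvd monom 1 (q ^ k) - monom 1 1"
    using field_poly_irreducible_imp_prime[OF assms(1)] prime_elem_dvd_power by blast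
  from ev_in_pideal[OF this] have "x ^ (q ^ k) + x \<in> pideal p"
    by (simp add: ev_diff ev_monom hom_simps char2_simps)
  then show ?thesis using ij(2) R.x by (intro exI[of _ k]) (auto simp: frob_fixed_def k_def)
qed

text \<open>T - a divides T^q + T, so the generators are already fixed for exponent 1. This sharper
  exponent is what puts the residues at zeros of \<open>X\<close> into the constant field.\<close>

lemma R_frob_fixed_linear: "R \<subseteq> frob_fixed [:- a, 1:] 1"
proof -
  have "poly (monom 1 q + monom 1 1) a = a + a"
    using power_card_finite_field[of a] by (simp add: poly_monom card)
  also have "a + a = 0"
  proof -
    have "\<iota> (a + a) = 0" unfolding hom_simps(3) by (rule add_self)
    then show ?thesis by (simp only: hom_simps(8))
  qed
  finally have "[:- a, 1:] dvd monom 1 q + monom 1 1" unfolding poly_eq_0_iff_dvd .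
  then have X: "X \<in> pideal [:- a, 1:]" unfolding X_as_ev by (rule ev_in_pideal)
  show ?thesis
  proof (rule R_subset_frob_fixed)
    show "x \<in> frob_fixed [:- a, 1:] 1" using X by (simp add: frob_fixed_def R.x X_def)
    have "y ^ q + y = x ^ q0 * X" using y_power_q by (simp add: char2_algebra)
    then show "y \<in> frob_fixed [:- a, 1:] 1"
      using pideal_mult'[OF R_power[OF R.x] X] by (simp add: frob_fixed_def R.y)
  qed
qed

text \<open>Modulo \<open>p\<close> the power \<open>g ^ (k + q ^ n)\<close> equals
  \<open>g ^ Suc k\<close>. It is a multiple of \<open>g ^ Suc (Suc k)\<close> because
  \<open>q ^ n \<ge> 2\<close>, so the exponent can be lowered step by step.\<close>

lemma pideal_reduced:
  assumes R: "R \<subseteq> frob_fixed p n" "n > 0" and g: "g \<in> R"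
  shows "g ^ Suc k \<in> pideal p \<Longrightarrow> g \<in> pideal p"
proof (induction k)
  case (Suc k)
  have q: "q ^ n \<ge> 2" using q_ge_8 self_le_power[of q n] R(2) by linarith
  have fix_g: "g ^ (q ^ n) + g \<in> pideal p" using R g by (auto simp: frob_fixed_def)
  have "k + q ^ n = Suc (Suc k) + (q ^ n - 2)" using q by simp
  then have "g ^ (k + q ^ n) = g ^ Suc (Suc k) * g ^ (q ^ n - 2)" by (simp only: power_add)
  then have "g ^ (k + q ^ n) \<in> pideal p" using pideal_mult[OF Suc.prems R_power[OF g]] by (simp only:)
  then have "g ^ (k + q ^ n) + g ^ k * (g ^ (q ^ n) + g) \<in> pideal p"
    by (intro pideal_add pideal_mult' R_power g fix_g)
  then have "g ^ Suc k \<in> pideal p" by (simp add: power_add char2_algebra)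
  then show ?case by (rule Suc.IH)
qed simp

end

text \<open>Again \<open>V\<close> need not be discrete a priori. The Frobenius exponent
  \<open>n\<close> is a parameter: it is even for a general \<open>p\<close> and 1 for a linear
  one.\<close>

locale suzuki_finite = suzuki \<iota> x m y z w + valuation_ring V
  for \<iota> :: "'f::{finite,field} \<Rightarrow> 'K::field" and x m y z w and V :: "'K set" +
  fixes p :: "'f poly" and n :: nat
  assumes R_V: "R \<subseteq> V"
    and irred: "irreducible p" and p_vmax: "ev p \<in> vmax"
    and frob: "R \<subseteq> frob_fixed p n" "n > 0"
begin

text \<open>The polynomials with value in the maximal ideal form a proper ideal. Its generator
  \<open>d\<close> of least degree divides the irreducible \<open>p\<close>, so it is associated to
  \<open>p\<close>.\<close>

lemma ev_in_vunit:
  assumes "\<not> p dvd r"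
  shows "ev r \<in> vunit"
proof (rule ccontr)
  assume "ev r \<notin> vunit"
  then have r: "ev r \<in> vmax" using R_V ev_in_R by (auto simp: vmax_def)
  have p0: "p \<noteq> 0" using irred by auto
  define P where "P s \<longleftrightarrow> s \<noteq> 0 \<and> ev s \<in> vmax" for s
  define d where "d = (ARG_MIN degree s. P s)"
  have d: "P d" and min: "\<And>s. P s \<Longrightarrow> degree d \<le> degree s"
    using arg_min_nat_lemma[of P p degree] p0 p_vmax unfolding d_def P_def by auto
  have dvd: "d dvd s" if "ev s \<in> vmax" for s
  proof -
    have "ev (s mod d) \<in> vmax"
    proof -
      have "s mod d = s - s div d * d" by (simp add: minus_div_mult_eq_mod)
      then have "ev (s mod d) = ev s - ev (s div d) * ev d" by (simp add: ev_diff ev_mult)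
      moreover have "ev (s div d) * ev d \<in> vmax"
        using d R_V ev_in_R unfolding P_def by (intro vmax_mult) auto
      ultimately show ?thesis using vmax_diff[OF that] by simp
    qed
    then show ?thesis
      using min[of "s mod d"] degree_mod_less'[of d s] d unfolding P_def
      by (metis linorder_not_less mod_eq_0_iff_dvd)
  qed
  then obtain k where k: "p = d * k" using p_vmax by blast
  have "\<not> d dvd 1"
  proof
    assume "d dvd 1"
    then obtain e where "1 = d * e" by blast
    then have "1 = ev d * ev e" using ev_1 ev_mult by metis
    then have "1 \<in> vmax" using d R_V ev_in_R vmax_mult unfolding P_def by (metis mult.commute subsetD)
    then show False using one_in_vunit vmax_not_vunit by blast
  qed
  then have "k dvd 1" using irred k by (auto dest: irreducibleD)
  then have "p dvd d" using k by (metis dvd_mult_unit_iff dvd_refl mult.commute mult_unit_dvd_iff)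
  then show False using dvd[OF r] assms dvd_trans by blast
qed

text \<open>\<open>r\<close> divides a polynomial in \<open>x\<close>, whose part prime to
  \<open>p\<close> is a unit. This bounds how often \<open>p\<close> can be extracted from
  \<open>r\<close>.\<close>

lemma exists_p_power_multiple:
  assumes "r \<in> R" "r \<noteq> 0"
  shows "\<exists>k. ev p ^ k / r \<in> V"
proof -
  obtain r' c where c: "r' \<in> R" "c \<noteq> 0" "r * r' = ev c" using R_divides_ev assms by blast
  have "p \<noteq> 0" "\<not> p dvd 1" using irred by (auto simp: irreducible_def)
  then have "degree p > 0" using is_unit_iff_degree[of p] by simp
  then obtain k c' where k: "c = p ^ k * c'" "\<not> p dvd c'" using prime_power_decompose c(2) by blast
  have u: "ev c' \<in> vunit" by (rule ev_in_vunit[OF k(2)])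
  have "ev p ^ k * ev c' = r * r'" using c k by (simp add: ev_mult ev_power)
  then have "ev p ^ k / r = r' * inverse (ev c')"
    using assms(2) vunit_nonzero[OF u] by (simp add: field_simps)
  then show ?thesis
    using ring_closed(5) c(1) R_V vunit_subset[OF vunit_inverse[OF u]] by (metis subsetD)
qed

text \<open>\<open>g ^ (q ^ n) + g\<close> factors as \<open>(1 + g ^ (q ^ n - 1)) * g\<close>, and
  the first factor is a unit when \<open>g\<close> is in the maximal ideal. So \<open>p\<close>
  divides \<open>g\<close> up to a unit, which makes \<open>p\<close> a uniformizer.\<close>

lemma R_vmax_step:
  assumes "g \<in> R" "g \<in> vmax"
  obtains s r where "s \<in> R" "s \<in> vunit" "r \<in> R" "s * g = ev p * r"
proof -
  have q: "q ^ n \<ge> 2" using q_ge_8 self_le_power[of q n] frob(2) by linarith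
  obtain r where r: "r \<in> R" "g ^ (q ^ n) + g = ev p * r"
    using frob(1) assms(1) unfolding frob_fixed_def pideal_def by blast
  define s where "s = 1 + g ^ (q ^ n - 1)"
  have "g ^ (q ^ n) = g ^ (q ^ n - 1) * g" using q by (metis power_minus_mult pos2 less_le_trans)
  then have "s * g = ev p * r" using r by (simp add: s_def distrib_right add.commute)
  moreover have "s \<in> vunit" unfolding s_def
    using q power_in_vmax_iff[of "q ^ n - 1" g] assms(2) by (intro vunit_add_vmax one_in_vunit) simp
  moreover have "s \<in> R" unfolding s_def by (intro R.add R_1 R_power assms)
  ultimately show ?thesis using that r by blast
qed

text \<open>Each application of \<open>R_vmax_step\<close> extracts one factor \<open>ev p\<close>
  and lowers the bound \<open>k\<close>, so the extraction ends at a unit.\<close>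

lemma R_unit_decomposition:
  assumes "r \<in> R" "r \<noteq> 0" "ev p ^ k / r \<in> V"
  shows "\<exists>j a b. a \<in> R \<and> b \<in> R \<and> a \<in> vunit \<and> b \<in> vunit \<and> b * r = ev p ^ j * a"
  using assms
proof (induction k arbitrary: r)
  case 0
  then have "r \<in> vunit" using R_V by (auto simp: vunit_def divide_inverse)
  then show ?case using 0 R_1 one_in_vunit by (intro exI[of _ 0] exI[of _ r] exI[of _ 1]) auto
next
  case (Suc k)
  show ?case
  proof (cases "r \<in> vunit")
    case True
    then show ?thesis using Suc R_1 one_in_vunit by (intro exI[of _ 0] exI[of _ r] exI[of _ 1]) auto
  next
    case False
    then have "r \<in> vmax" using Suc.prems R_V by (auto simp: vmax_def)
    then obtain s r' where s: "s \<in> R" "s \<in> vunit" "r' \<in> R" "s * r = ev p * r'"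
      using R_vmax_step Suc.prems(1) by blast
    have p0: "ev p \<noteq> 0" using irred ev_eq_0_iff by auto
    have s0: "s \<noteq> 0" using s vunit_nonzero by blast
    have r': "r' = s * r / ev p" using s(4) p0 by (simp add: field_simps)
    then have "r' \<noteq> 0" using s0 p0 Suc.prems by simp
    moreover have "ev p ^ k / r' = ev p ^ Suc k / r * inverse s"
      unfolding r' using p0 s0 Suc.prems(2) by (simp add: field_simps)
    then have "ev p ^ k / r' \<in> V"
      using ring_closed(5)[OF Suc.prems(3) vunit_subset[OF vunit_inverse[OF s(2)]]] by (simp only:)
    ultimately obtain j a b where ab: "a \<in> R" "b \<in> R" "a \<in> vunit" "b \<in> vunit" "b * r' = ev p ^ j * a"
      using Suc.IH[OF s(3)] by blast
    have "(b * s) * r = b * (ev p * r')" using s(4) by (simp add: mult.assoc)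
    also have "\<dots> = ev p ^ Suc j * a" using ab(5) by (simp add: mult.left_commute mult.assoc)
    finally show ?thesis
      using ab s by (intro exI[of _ "Suc j"] exI[of _ a] exI[of _ "b * s"]) (auto intro: R.mult vunit_mult)
  qed
qed

text \<open>The units are given as elements of \<open>R\<close> because the residue computation at
  zeros of \<open>X\<close> applies the Frobenius congruence to them.\<close>

lemma unit_decomposition:
  assumes "f \<noteq> 0"
  obtains k :: int and a b where "a \<in> R" "b \<in> R" "a \<in> vunit" "b \<in> vunit" "f = ev p powi k * (a / b)"
proof -
  obtain c r where c: "c \<noteq> 0" "r \<in> R" "ev c * f = r" using exists_denominator by blast
  have nz1: "ev c \<noteq> 0" using c(1) by (simp only: ev_eq_0_iff not_False_eq_True)
  have nz2: "r \<noteq> 0" unfolding c(3)[symmetric] using nz1 assms by simp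
  note nz = nz1 nz2
  obtain j a b where ab: "a \<in> R" "b \<in> R" "a \<in> vunit" "b \<in> vunit" "b * r = ev p ^ j * a"
    using R_unit_decomposition[OF c(2) nz(2)] exists_p_power_multiple[OF c(2) nz(2)] by blast
  obtain j' a' b' where ab': "a' \<in> R" "b' \<in> R" "a' \<in> vunit" "b' \<in> vunit" "b' * ev c = ev p ^ j' * a'"
    using R_unit_decomposition[OF ev_in_R nz(1)] exists_p_power_multiple[OF ev_in_R nz(1)] by blast
  have p0: "ev p \<noteq> 0" using irred ev_eq_0_iff by auto
  have nz': "a \<noteq> 0" "b \<noteq> 0" "a' \<noteq> 0" "b' \<noteq> 0" using ab ab' vunit_nonzero by auto
  have "r = ev p ^ j * a / b" "ev c = ev p ^ j' * a' / b'"
    using ab(5) ab'(5) nz' by (simp_all add: nonzero_eq_divide_eq mult.commute)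
  moreover have "f = r / ev c" using c(3) nz by (simp add: nonzero_eq_divide_eq mult.commute)
  ultimately have "f = (ev p ^ j / ev p ^ j') * ((a * b') / (b * a'))"
    by (simp only: divide_inverse inverse_mult_distrib inverse_inverse_eq mult_ac)
  also have "ev p ^ j / ev p ^ j' = ev p powi (int j - int j')" using p0 by (simp add: power_int_diff)
  finally show ?thesis
    using ab ab' by (intro that[of "a * b'" "b * a'"]) (auto intro: R.mult vunit_mult)
qed

lemma exists_finite_place:
  obtains v where "is_place \<iota> v" "v (ev p) = 1" "\<And>f. f \<noteq> 0 \<Longrightarrow> 0 \<le> v f \<longleftrightarrow> f \<in> V"
proof (rule uniformizer_imp_place[OF hom _ p_vmax])
  show "range \<iota> \<subseteq> V" using R.const R_V by blast
  show p0: "ev p \<noteq> 0" using irred ev_eq_0_iff by auto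
  show "\<exists>n::int. f / ev p powi n \<in> vunit" if f: "f \<noteq> 0" for f
  proof -
    obtain k a b where "a \<in> vunit" "b \<in> vunit" "f = ev p powi k * (a / b)"
      using unit_decomposition[OF f] by metis
    then have "f / ev p powi k \<in> vunit" using p0 vunit_divide[of a b] by simp
    then show ?thesis by blast
  qed
qed (use that in blast)

end

context suzuki
begin

section \<open>Functions without poles at finite places\<close>

lemma regular_imp_in_R:
  assumes h: "h \<noteq> 0" and reg: "\<And>v. is_place \<iota> v \<Longrightarrow> 0 \<le> v x \<Longrightarrow> 0 \<le> v h"
  shows "h \<in> R"
proof -
  define P where "P c \<longleftrightarrow> c \<noteq> 0 \<and> ev c * h \<in> R" for c
  define B where "B = (ARG_MIN degree c. P c)"
  have "\<exists>c. P c" using exists_denominator[of h] unfolding P_def by blast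
  then have B: "P B" and min: "\<And>c. P c \<Longrightarrow> degree B \<le> degree c"
    using arg_min_nat_lemma[of P _ degree] unfolding B_def by blast+
  show ?thesis
  proof (cases "degree B = 0")
    case True
    then obtain b where b: "B = [:b:]" by (rule degree_eq_zeroE)
    then have b0: "b \<noteq> 0" and mem: "\<iota> b * h \<in> R" using B unfolding P_def by auto
    have "\<iota> (inverse b) * \<iota> b = 1" using b0 by (simp add: hom_simps(2) flip: hom_simps(4))
    then have "\<iota> (inverse b) * (\<iota> b * h) = h" by (simp flip: mult.assoc)
    then show ?thesis using R.mult[OF R.const mem, of "inverse b"] by (simp only:)
  next
    case False
    then obtain p where p: "p dvd B" "irreducible p" "degree p > 0" using exists_irreducible_factor by blast
    then obtain B' where B': "B = p * B'" by blast
    have p0: "p \<noteq> 0" "ev p \<noteq> 0" and B'0: "B' \<noteq> 0" using B B' ev_eq_0_iff unfolding P_def by auto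
    define g where "g = ev B * h"
    have g: "g \<in> R" "g \<noteq> 0" using B h ev_eq_0_iff unfolding g_def P_def by auto
    \<comment> \<open>Otherwise \<open>p\<close> could be cancelled, leaving the denominator
      \<open>B'\<close> of smaller degree.\<close>
    have "g \<notin> pideal p"
    proof
      assume "g \<in> pideal p"
      then obtain r where "r \<in> R" "g = ev p * r" unfolding pideal_def by blast
      then have "ev B' * h = r" using p0 unfolding g_def B' ev_mult by simp
      then have "degree B \<le> degree B'" using min B'0 \<open>r \<in> R\<close> unfolding P_def by blast
      then show False using B' p(3) p0 B'0 by (simp add: degree_mult_eq)
    qed
    obtain k where "k > 0" "x \<in> frob_fixed p k" using x_frob_fixed p by blast
    then have frob: "R \<subseteq> frob_fixed p (2 * k)" "2 * k > 0" using R_frob_fixed by auto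
    \<comment> \<open>\<open>R\<close> modulo \<open>p\<close> is reduced; exponent 0 is separate
      because \<open>pideal_reduced\<close> speaks of positive exponents.\<close>
    have g_pow: "g ^ j \<notin> pideal p" for j
    proof (cases j)
      case 0
      have "1 \<notin> pideal p" using \<open>g \<notin> pideal p\<close> pideal_mult[of 1 p g] g by auto
      then show ?thesis using 0 by simp
    qed (use pideal_reduced[OF frob g(1)] \<open>g \<notin> pideal p\<close> in blast)
    \<comment> \<open>The ring R[1/g]. If it contained \<open>inverse (ev p)\<close>, some power of
      \<open>g\<close> would be a multiple of \<open>ev p\<close>.\<close>
    define A where "A = {r / g ^ j | r j. r \<in> R}"
    have AI: "f \<in> A" if "f = r / g ^ j" "r \<in> R" for f r j unfolding A_def using that by blast
    have RA: "r \<in> A" if "r \<in> R" for r by (rule AI[of _ r 0]) (use that in auto)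
    have sub: "subring_of_field A"
      unfolding subring_of_field_def
    proof (intro conjI ballI)
      show "1 \<in> A" using RA R_1 by blast
      fix a b assume "a \<in> A" "b \<in> A"
      then obtain r j r' j' where ab: "a = r / g ^ j" "r \<in> R" "b = r' / g ^ j'" "r' \<in> R"
        unfolding A_def by blast
      show "a * b \<in> A"
        by (rule AI[of _ "r * r'" "j + j'"]) (use ab in \<open>auto simp: power_add intro: R.mult\<close>)
      have "a - b = (r * g ^ j' - r' * g ^ j) / g ^ (j + j')"
        unfolding ab using g(2) by (simp add: power_add field_simps)
      then show "a - b \<in> A" by (rule AI) (intro R_diff R.mult R_power ab g)
    qed
    have "inverse (ev p) \<notin> A"
    proof
      assume "inverse (ev p) \<in> A"
      then obtain r j where r: "inverse (ev p) = r / g ^ j" "r \<in> R" unfolding A_def by blast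
      then have "g ^ j = ev p * r" using p0 g(2) by (simp add: field_simps)
      then show False using g_pow pidealI[OF r(2)] by metis
    qed
    then obtain V where V: "valuation_ring V" "A \<subseteq> V" "inverse (ev p) \<notin> V"
      using exists_valuation_ring[OF sub RA[OF ev_in_R]] by blast
    interpret valuation_ring V by (rule V(1))
    have RV: "R \<subseteq> V" using RA V(2) by blast
    have "ev p \<in> vmax" using V(3) vmax_iff by blast
    then interpret suzuki_finite \<iota> x m y z w V p "2 * k"
      by unfold_locales (use RV p frob in auto)
    obtain v where v: "is_place \<iota> v" "v (ev p) = 1" "\<And>f. f \<noteq> 0 \<Longrightarrow> 0 \<le> v f \<longleftrightarrow> f \<in> V"
      using exists_finite_place by blast
    interpret place \<iota> v by (intro place.intro hom v(1))
    \<comment> \<open>As \<open>g\<close> is invertible in \<open>V\<close>, its value is at most 0.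
      But \<open>g\<close> is the product of \<open>ev p\<close> of value 1 and of
      \<open>ev B'\<close> and \<open>h\<close>, which have no pole here.\<close>
    have "inverse g \<in> A" by (rule AI[of _ 1 1]) (auto simp: R_1 divide_inverse)
    then have "0 \<le> v (inverse g)" using v(3)[of "inverse g"] V(2) g(2) by auto
    then have "v g \<le> 0" using val_inverse[OF g(2)] by simp
    have "0 \<le> v h" using reg[OF v(1)] v(3)[OF x_nonzero] RV R.x by blast
    moreover have "0 \<le> v (ev B')" using v(3)[of "ev B'"] RV ev_in_R B'0 ev_eq_0_iff by blast
    moreover have "v g = v (ev p) + v (ev B') + v h"
      using h p0 B'0 ev_eq_0_iff by (simp add: g_def B' ev_mult val_mult)
    ultimately show ?thesis using v(2) \<open>v g \<le> 0\<close> by simp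
  qed
qed

end

section \<open>Finite places, zeros of \<open>X\<close> and rationality\<close>

locale suzuki_affine_place = suzuki \<iota> x m y z w + place \<iota> v
  for \<iota> :: "'f::{finite,field} \<Rightarrow> 'K::field" and x m y z w and v :: "'K \<Rightarrow> int" +
  assumes x_nonneg: "0 \<le> v x"
begin

text \<open>The curve equation is of Artin-Schreier type in \<open>y\<close>, so \<open>y\<close>
  cannot have a pole where \<open>x\<close> has none.\<close>

lemma val_ge_R: "r \<in> R \<Longrightarrow> val_ge v r 0"
proof -
  interpret valuation_ring "{f. val_ge v f 0}" by (rule valuation_ring_of_place)
  have x: "x \<in> {f. val_ge v f 0}" using x_nonneg by (simp add: val_ge_def)
  have "y ^ q + y = x ^ q0 * (x ^ q + x)" by (rule curve)
  also have "\<dots> \<in> {f. val_ge v f 0}" by (intro ring_closed x)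
  finally have y: "y \<in> {f. val_ge v f 0}" by (rule artin_schreier_in_V) (use q_ge_8 in simp)
  assume "r \<in> R"
  then have "r \<in> {f. val_ge v f 0}"
    by (induction rule: R.induct) (use x y ring_closed(5,6) val_ge_const in auto)
  then show ?thesis by simp
qed

text \<open>\<open>X\<close> is the product of all \<open>x - \<iota> a\<close>, so one of these
  vanishes at the place and is a uniformizer. The cofactor of it in \<open>X\<close> is a unit, and
  residues are fixed by the \<open>q\<close>-th power, hence constants.\<close>

lemma val_X_and_rational:
  assumes "val_ge v X 1"
  shows "v X = 1" "is_rational_place \<iota> v"
proof -
  have "val_ge v (x ^ CARD('f) - x) 1" using assms by (simp add: card X_def char2_simps)
  from exists_residue[OF _ this prod_linear_eq[OF hom]] obtain a where a: "val_ge v (x - \<iota> a) 1" by auto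
  define p where "p = [:- a, 1:]"
  have ev_p: "ev p = x - \<iota> a" by (simp add: p_def hom_simps)
  have p0: "ev p \<noteq> 0" unfolding ev_eq_0_iff by (simp add: p_def)
  interpret valuation_ring "{f. val_ge v f 0}" by (rule valuation_ring_of_place)
  interpret suzuki_finite \<iota> x m y z w "{f. val_ge v f 0}" p 1
  proof unfold_locales
    show "irreducible p" unfolding p_def by (rule irreducible_linear_field_poly) simp
    show "R \<subseteq> frob_fixed p 1" unfolding p_def by (rule R_frob_fixed_linear)
    show "ev p \<in> valuation_ring.vmax {f. val_ge v f 0}" using a ev_p vmax_of_place by simp
  qed (use val_ge_R in auto)
  have val_unit: "v u = 0" if "u \<in> vunit" for u using that vunit_of_place by blast
  have val_decomp: "v (ev p powi k * (u / u')) = k * v (ev p)" if "u \<in> vunit" "u' \<in> vunit" for k u u'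
    using that val_unit vunit_nonzero p0 by (simp add: val_mult val_divide val_powi)
  have vp: "v (ev p) > 0" using a p0 unfolding ev_p by (simp add: val_ge_def)
  \<comment> \<open>All values are multiples of \<open>v (ev p)\<close>, and 1 is a value.\<close>
  have "v (ev p) = 1"
  proof -
    obtain f where f: "f \<noteq> 0" "v f = 1" using val_surj by blast
    then obtain k u u' where "u \<in> vunit" "u' \<in> vunit" "f = ev p powi k * (u / u')"
      using unit_decomposition by metis
    then have "k * v (ev p) = 1" using val_decomp f(2) by simp
    then show ?thesis using vp by (metis mult.commute pos_zmult_eq_1_iff)
  qed
  moreover have "X = ev p * (ev p ^ (q - 1) + 1)"
  proof -
    have "\<iota> a ^ q = \<iota> a" by (rule const_power_q)
    then have "X = ev p ^ q + ev p"
      unfolding X_def ev_p char2_simps frob_q by (simp add: char2_algebra)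
    moreover have "ev p ^ q = ev p * ev p ^ (q - 1)"
      using q_ge_8 by (metis power_eq_if not_numeral_le_zero)
    ultimately show ?thesis by (simp add: algebra_simps)
  qed
  moreover have "ev p ^ (q - 1) \<in> vmax"
    using power_in_vmax_iff[of "q - 1" "ev p"] p_vmax q_ge_8 by simp
  from vunit_add_vmax[OF one_in_vunit this] have "ev p ^ (q - 1) + 1 \<in> vunit"
    by (simp only: add.commute)
  ultimately show "v X = 1" using p0 val_unit vunit_nonzero by (simp add: val_mult)
  show "is_rational_place \<iota> v"
    unfolding is_rational_place_def
  proof (intro conjI allI impI place)
    fix f assume f: "f \<noteq> 0" "0 \<le> v f"
    show "\<exists>c. f = \<iota> c \<or> (f - \<iota> c \<noteq> 0 \<and> v (f - \<iota> c) > 0)"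
    proof (cases "v f = 0")
      case False
      then show ?thesis using f by (intro exI[of _ 0]) (simp add: hom_simps)
    next
      case True
      obtain k u u' where u: "u \<in> R" "u' \<in> R" "u \<in> vunit" "u' \<in> vunit" "f = ev p powi k * (u / u')"
        using unit_decomposition[OF f(1)] by metis
      then have "k * v (ev p) = 0" using val_decomp True by metis
      then have "k = 0" using vp by simp
      then have fu: "f = u / u'" using u(5) by simp
      have nz: "u' \<noteq> 0" using u vunit_nonzero by blast
      have res: "val_ge v (r ^ q + r) 1" if "r \<in> R" for r
      proof -
        have "r ^ q + r \<in> pideal p" using frob(1) that unfolding frob_fixed_def by auto
        then obtain s where "s \<in> R" "r ^ q + r = ev p * s" unfolding pideal_def by blast
        then show ?thesis using val_ge_mult[of "ev p" 1 s 0] a val_ge_R unfolding ev_p by simp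
      qed
      \<comment> \<open>Over the common denominator, the term \<open>u * u'\<close> is inserted
        twice, which changes nothing in characteristic 2 and exposes the two Frobenius
        congruences.\<close>
      have "f ^ q - f = ((u ^ q + u) * u' + u * (u' ^ q + u')) * inverse (u' ^ q * u')"
        unfolding fu using nz by (simp add: power_divide field_simps char2_simps char2_algebra)
      moreover have "val_ge v ((u ^ q + u) * u' + u * (u' ^ q + u')) 1"
        using val_ge_mult[OF res[OF u(1)] val_ge_R[OF u(2)]] val_ge_mult[OF val_ge_R[OF u(1)] res[OF u(2)]]
        by (intro val_ge_add) simp_all
      moreover have "val_ge v (inverse (u' ^ q * u')) 0"
        using u(4) by (simp add: val_ge_def val_inverse val_mult val_power nz val_unit)
      ultimately have "val_ge v (f ^ CARD('f) - f) 1"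
        using val_ge_mult[of "(u ^ q + u) * u' + u * (u' ^ q + u')" 1 "inverse (u' ^ q * u')" 0]
        by (simp add: card)
      from exists_residue[OF _ this prod_linear_eq[OF hom]] obtain c where "val_ge v (f - \<iota> c) 1" by auto
      then show ?thesis by (intro exI[of _ c]) (auto simp: val_ge_def)
    qed
  qed
qed

end


subsection \<open>Riemann-Roch spaces\<close>

lemma (in suzuki_inf_place) val_X_inf: "v X = - int (q\<^sup>2)"
  using val_smon[of 0 0 0 0 1] by (simp add: smon_def pole_def)

text \<open>Subtracting the residue \<open>c\<close> of \<open>x\<close> does not change
  \<open>x ^ q + x\<close>, which then visibly vanishes at the place.\<close>

lemma (in suzuki_affine_place) rational_imp_val_X:
  assumes "is_rational_place \<iota> v"
  shows "val_ge v X 1"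
proof -
  obtain c where c: "x = \<iota> c \<or> (x - \<iota> c \<noteq> 0 \<and> v (x - \<iota> c) > 0)"
    using assms x_nonneg x_nonzero unfolding is_rational_place_def by blast
  then have t: "val_ge v (x - \<iota> c) 1" by (auto simp: val_ge_def)
  have "X = (x - \<iota> c) ^ q + (x - \<iota> c)"
    unfolding X_def char2_simps frob_q const_power_q by (simp add: char2_algebra)
  moreover have "val_ge v ((x - \<iota> c) ^ q) 1"
    using t q_ge_8 by (cases "x - \<iota> c = 0") (auto simp: val_ge_def val_power zero_power
      intro: order_trans[OF _ mult_mono[of 1 "int q" 1]])
  ultimately show ?thesis using val_ge_add t by simp
qed

context suzuki
begin

definition rr_basis :: "nat \<Rightarrow> 'K set" where
  "rr_basis l = {x ^ a * y ^ b * z ^ c * w ^ d / (x ^ q + x) ^ r | a b c d r.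
     a * q + b * (q + q0) + c * (q + 2 * q0) + d * (q + 2 * q0 + 1) \<le> r * q ^ 2 + l
     \<and> a \<le> q - 1 \<and> b \<le> 1 \<and> c \<le> q0 - 1 \<and> d \<le> q0 - 1 \<and> r \<le> l}"

lemma rr_basisE:
  assumes "f \<in> rr_basis l"
  obtains a b c d r where "f = smon a b c d 0 / X ^ r" "pole a b c d 0 \<le> r * q\<^sup>2 + l"
    "a < q" "b \<in> {0,1}" "c < q0" "d < q0" "r \<le> l"
proof -
  obtain a b c d r where f: "f = x ^ a * y ^ b * z ^ c * w ^ d / (x ^ q + x) ^ r"
    and le: "a * q + b * (q + q0) + c * (q + 2 * q0) + d * (q + 2 * q0 + 1) \<le> r * q ^ 2 + l"
    and bounds: "a \<le> q - 1" "b \<le> 1" "c \<le> q0 - 1" "d \<le> q0 - 1" "r \<le> l"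
    using assms unfolding rr_basis_def by blast
  show ?thesis
  proof (rule that)
    show "f = smon a b c d 0 / X ^ r" by (simp add: f smon_def X_def)
    show "pole a b c d 0 \<le> r * q\<^sup>2 + l" using le by (simp add: pole_def)
    show "a < q" "c < q0" "d < q0" using bounds q_ge_8 q0_ge_2 by linarith+
    show "b \<in> {0,1}" using bounds(2) by auto
  qed (rule bounds)
qed

lemma rr_basisI:
  assumes "pole a b c d 0 \<le> r * q\<^sup>2 + l" "a < q" "b \<in> {0,1}" "c < q0" "d < q0" "r \<le> l"
  shows "smon a b c d 0 / X ^ r \<in> rr_basis l"
proof -
  have "b \<le> 1" "a \<le> q - 1" "c \<le> q0 - 1" "d \<le> q0 - 1" using assms by auto
  moreover have "smon a b c d 0 / X ^ r = x ^ a * y ^ b * z ^ c * w ^ d / (x ^ q + x) ^ r"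
    by (simp add: smon_def X_def)
  moreover have "a * q + b * (q + q0) + c * (q + 2 * q0) + d * (q + 2 * q0 + 1) \<le> r * q ^ 2 + l"
    using assms(1) by (simp add: pole_def)
  ultimately show ?thesis using assms(6) unfolding rr_basis_def by blast
qed

text \<open>Because \<open>r \<le> l\<close>, multiplication by \<open>X ^ l\<close> clears the
  denominator and leaves exponent \<open>l - r\<close> of \<open>X\<close>.\<close>

lemma rr_basis_times: "f \<in> rr_basis l \<Longrightarrow> f * X ^ l \<in> smons {0,1}"
proof (erule rr_basisE)
  fix a b c d r
  assume f: "f = smon a b c d 0 / X ^ r" and bounds: "a < q" "b \<in> {0,1}" "c < q0" "d < q0" "r \<le> l"
  have "X ^ l = X ^ (l - r) * X ^ r" using bounds(5) by (simp flip: power_add)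
  then have "f * X ^ l = smon a b c d (l - r)" unfolding f using X_nonzero by (simp add: smon_def)
  then show ?thesis using bounds by (simp add: smonsI)
qed

lemma span_over_eq: "span_over \<iota> S = vs.span S"
  by (simp add: span_over_def vs.span_explicit)

text \<open>Moves the exceptional case \<open>f = 0\<close> inside the quantifier over places, where
  the closure rules of \<open>val_ge\<close> apply.\<close>

lemma RR_iff: "f \<in> RR_lD \<iota> l \<longleftrightarrow>
  (\<forall>v. is_place \<iota> v \<longrightarrow> val_ge v f (if is_rational_place \<iota> v then - int l else 0))"
  using exists_place_at_infinity unfolding RR_lD_def val_ge_def by auto

lemma RR_subspace: "vs.subspace (RR_lD \<iota> l)"
  unfolding vs.subspace_def
proof (intro conjI ballI allI)
  show "0 \<in> RR_lD \<iota> l" by (simp add: RR_iff val_ge_def)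
  fix f g c assume f: "f \<in> RR_lD \<iota> l"
  show "\<iota> c * f \<in> RR_lD \<iota> l"
    using f place.val_ge_scale[OF place.intro[OF hom]] unfolding RR_iff by blast
  assume "g \<in> RR_lD \<iota> l"
  then show "f + g \<in> RR_lD \<iota> l"
    using f place.val_ge_add[OF place.intro[OF hom]] unfolding RR_iff by blast
qed

text \<open>At infinity the weight inequality is the required bound on the pole. At finite places
  the numerator is regular, and \<open>X\<close> has at most simple zeros, all at rational places,
  so \<open>r \<le> l\<close> suffices.\<close>

lemma rr_basis_subset_RR: "rr_basis l \<subseteq> RR_lD \<iota> l"
proof
  fix f assume "f \<in> rr_basis l"
  then obtain a b c d r where f: "f = smon a b c d 0 / X ^ r" and le: "pole a b c d 0 \<le> r * q\<^sup>2 + l"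
    and r: "r \<le> l" by (rule rr_basisE)
  show "f \<in> RR_lD \<iota> l"
    unfolding RR_iff
  proof (intro allI impI)
    fix v assume v: "is_place \<iota> v"
    interpret place \<iota> v by (rule place.intro[OF hom v])
    show "val_ge v f (if is_rational_place \<iota> v then - int l else 0)"
    proof (cases "v x < 0")
      case True
      then interpret suzuki_inf_place \<iota> x m y z w v by unfold_locales
      have "v f = int r * int (q\<^sup>2) - int (pole a b c d 0)"
        using smon_nonzero X_nonzero by (simp add: f val_divide val_power val_smon val_X_inf)
      moreover have "int (pole a b c d 0) \<le> int (r * q\<^sup>2 + l)" using le by (simp only: of_nat_le_iff)
      ultimately have "v f \<ge> - int l" by simp
      then show ?thesis using rational by (simp add: val_ge_def)
    next
      case False
      then interpret suzuki_affine_place \<iota> x m y z w v by unfold_locales simp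
      have "val_ge v f (- int r * v X)"
        using val_ge_mult[of "smon a b c d 0" 0 "inverse (X ^ r)" "- int r * v X"]
          val_ge_R[OF smon_in_R] X_nonzero
        by (simp add: f divide_inverse val_ge_def val_inverse val_power)
      moreover have "v X = 0 \<or> v X = 1 \<and> is_rational_place \<iota> v"
      proof (cases "v X = 0")
        case False
        then have "val_ge v X 1" using val_ge_R[OF X_in_R] X_nonzero by (simp add: val_ge_def)
        then show ?thesis using val_X_and_rational by simp
      qed simp
      ultimately show ?thesis using r by (auto elim!: val_ge_mono)
    qed
  qed
qed

text \<open>Multiplication by \<open>X ^ l\<close> shifts all values at infinity equally and leads
  to monomials, which have distinct values.\<close>

lemma rr_basis_independent: "lin_indep_over \<iota> (rr_basis l)"
  unfolding lin_indep_over_def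
proof (intro allI impI)
  fix T c assume T: "finite T \<and> T \<subseteq> rr_basis l \<and> (\<Sum>s\<in>T. \<iota> (c s) * s) = 0"
  obtain v where v: "is_place \<iota> v" "v x < 0" using exists_place_at_infinity by blast
  interpret suzuki_inf_place \<iota> x m y z w v
    by (intro suzuki_inf_place.intro suzuki_axioms place.intro hom suzuki_inf_place_axioms.intro v)
  define T' where "T' = {s\<in>T. c s \<noteq> 0}"
  have T': "finite T'" "T' \<subseteq> rr_basis l" using T by (auto simp: T'_def)
  have sum: "(\<Sum>s\<in>T'. \<iota> (c s) * s) = 0"
    using T sum.mono_neutral_right[of T T' "\<lambda>s. \<iota> (c s) * s"] by (auto simp: T'_def hom_simps)
  have nz: "s \<noteq> 0" if "s \<in> rr_basis l" for s
    using that smon_nonzero X_nonzero by (auto elim!: rr_basisE)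
  have val: "v (\<iota> (c s) * s) = v (s * X ^ l) - int l * v X" if "s \<in> T'" for s
    using that nz T' X_nonzero by (auto simp: T'_def val_mult val_const val_power hom_simps)
  have inj: "inj_on (\<lambda>s. v (\<iota> (c s) * s)) T'"
  proof (rule inj_onI)
    fix s s' assume s: "s \<in> T'" "s' \<in> T'" "v (\<iota> (c s) * s) = v (\<iota> (c s') * s')"
    then have "v (s * X ^ l) = v (s' * X ^ l)" using val by simp
    then have "s * X ^ l = s' * X ^ l" using val_smons_inj rr_basis_times s T' by blast
    then show "s = s'" using X_nonzero by simp
  qed
  have "\<iota> (c s) * s \<noteq> 0" if "s \<in> T'" for s
    using that nz T' by (auto simp: T'_def hom_simps)
  from val_sum_distinct[OF T'(1) _ this inj] have "T' = {}" using sum by auto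
  then show "\<forall>s\<in>T. c s = 0" by (auto simp: T'_def)
qed

text \<open>\<open>X ^ l * f\<close> is regular at finite places, hence a combination of monomials.
  At infinity no monomial in it has a larger pole than the sum, so dividing each by
  \<open>X ^ l\<close> gives an element of \<open>rr_basis l\<close>.\<close>

lemma RR_subset_span:
  assumes l: "l \<le> q\<^sup>2 - 1" and f: "f \<in> RR_lD \<iota> l"
  shows "f \<in> vs.span (rr_basis l)"
proof (cases "f = 0")
  case True
  then show ?thesis using vs.span_zero by simp
next
  case False
  define h where "h = X ^ l * f"
  have h0: "h \<noteq> 0" using False X_nonzero by (simp add: h_def)
  have "h \<in> R"
  proof (rule regular_imp_in_R[OF h0])
    fix v assume v: "is_place \<iota> v" "0 \<le> v x"
    interpret suzuki_affine_place \<iota> x m y z w v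
      by (intro suzuki_affine_place.intro suzuki_axioms place.intro hom suzuki_affine_place_axioms.intro v)
    have vh: "v h = int l * v X + v f" using False X_nonzero by (simp add: h_def val_mult val_power)
    have vf: "v f \<ge> (if is_rational_place \<iota> v then - int l else 0)"
      using f v False unfolding RR_iff val_ge_def by blast
    have vX: "v X \<ge> 0" using val_ge_R[OF X_in_R] X_nonzero by (simp add: val_ge_def)
    show "0 \<le> v h"
    proof (cases "is_rational_place \<iota> v")
      case True
      then have "v X \<ge> 1" using rational_imp_val_X X_nonzero by (simp add: val_ge_def)
      then have "int l * 1 \<le> int l * v X" by (intro mult_left_mono) simp_all
      then show ?thesis using vf vh True by simp
    qed (use vf vh vX in simp)
  qed
  obtain v where v: "is_place \<iota> v" "v x < 0" using exists_place_at_infinity by blast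
  interpret suzuki_inf_place \<iota> x m y z w v
    by (intro suzuki_inf_place.intro suzuki_axioms place.intro hom suzuki_inf_place_axioms.intro v)
  obtain T c where T: "finite T" "T \<subseteq> smons {0,1}" "\<forall>s\<in>T. c s \<noteq> 0" "h = (\<Sum>s\<in>T. \<iota> (c s) * s)"
    by (rule R_combination[OF \<open>h \<in> R\<close>])
  then have "T \<noteq> {}" using h0 by auto
  from val_smon_combination[OF T(1-3) this] have val: "v h \<le> v s" if "s \<in> T" for s
    using that unfolding T(4)[symmetric] by (metis order_less_imp_le order_refl)
  have "v f \<ge> - int l" using f v False rational unfolding RR_iff val_ge_def by force
  then have vh: "v h \<ge> - int (l * q\<^sup>2 + l)"
    using False X_nonzero by (simp add: h_def val_mult val_power val_X_inf)
  have "s / X ^ l \<in> rr_basis l" if sT: "s \<in> T" for s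
  proof -
    have "s \<in> smons {0,1}" using sT T(2) by blast
    then obtain a b c d e where s: "s = smon a b c d e" "a < q" "b \<in> {0,1}" "c < q0" "d < q0"
      by (rule smonsE)
    have "- int (l * q\<^sup>2 + l) \<le> - int (pole a b c d e)"
      using vh val[OF sT] unfolding s(1) val_smon by linarith
    then have "pole a b c d e \<le> l * q\<^sup>2 + l" by linarith
    then have le: "pole a b c d 0 + e * q\<^sup>2 \<le> l * q\<^sup>2 + l" by (simp add: pole_def)
    have "q\<^sup>2 > 0" using q_ge_8 by simp
    \<comment> \<open>This is where the bound on \<open>l\<close> enters: it gives
      \<open>e * q\<^sup>2 \<le> l * q\<^sup>2 + l < Suc l * q\<^sup>2\<close>, so the exponent
      \<open>l - e\<close> of the denominator involves no truncation.\<close>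
    then have "l < q\<^sup>2" using l by linarith
    then have "e * q\<^sup>2 < Suc l * q\<^sup>2" using le unfolding mult_Suc by linarith
    then have "e \<le> l" by (simp only: mult_less_cancel2) simp
    then have "X ^ l = X ^ (l - e) * X ^ e" by (simp flip: power_add)
    then have "s / X ^ l = smon a b c d 0 / X ^ (l - e)" using X_nonzero by (simp add: s smon_def)
    moreover have "pole a b c d 0 \<le> (l - e) * q\<^sup>2 + l" using le \<open>e \<le> l\<close> by (simp add: diff_mult_distrib)
    ultimately show ?thesis using rr_basisI s by simp
  qed
  then have "(\<Sum>s\<in>T. \<iota> (c s) * (s / X ^ l)) \<in> vs.span (rr_basis l)"
    by (intro vs.span_sum vs.span_scale vs.span_base)
  also have "(\<Sum>s\<in>T. \<iota> (c s) * (s / X ^ l)) = h / X ^ l" by (simp add: T(4) sum_divide_distrib)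
  also have "\<dots> = f" using X_nonzero by (simp add: h_def)
  finally show ?thesis .
qed

lemma rr_basis_is_basis:
  assumes "l \<le> q\<^sup>2 - 1"
  shows "basis_over \<iota> (rr_basis l) (RR_lD \<iota> l)"
  unfolding basis_over_def span_over_eq
  using rr_basis_independent RR_subset_span[OF assms] vs.span_minimal[OF rr_basis_subset_RR RR_subspace]
  by blast

end

theorem theorem3p1:
  fixes m l :: nat and \<iota> :: "'f::{finite,field} \<Rightarrow> 'K::field" and x y z w :: 'K
  assumes "m \<ge> 1"
    and "CARD('f) = suz_q m"
    and "is_field_hom \<iota>"
    and "transcendental_over \<iota> x"
    and "y ^ suz_q m + y = x ^ suz_q0 m * (x ^ suz_q m + x)"
    and "generated_by \<iota> x y"
    and "z = x ^ (2 * suz_q0 m + 1) - y ^ (2 * suz_q0 m)"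
    and "w = x * y ^ (2 * suz_q0 m) - z ^ (2 * suz_q0 m)"
    and "l \<le> suz_q m ^ 2 - 1"
  shows "basis_over \<iota>
     {x ^ a * y ^ b * z ^ c * w ^ d / (x ^ suz_q m + x) ^ r | a b c d r.
        a * suz_q m + b * (suz_q m + suz_q0 m) + c * (suz_q m + 2 * suz_q0 m)
          + d * (suz_q m + 2 * suz_q0 m + 1) \<le> r * suz_q m ^ 2 + l
        \<and> a \<le> suz_q m - 1 \<and> b \<le> 1 \<and> c \<le> suz_q0 m - 1 \<and> d \<le> suz_q0 m - 1 \<and> r \<le> l}
     (RR_lD \<iota> l)"
proof -
  interpret suzuki \<iota> x m y z w
    by (intro suzuki.intro eval_at.intro suzuki_axioms.intro assms)
  show ?thesis using rr_basis_is_basis[OF assms(9)] unfolding rr_basis_def .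
qed

end
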